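(* Let $(\mathcal{X},T)$ be a dynamical system with a metric $d$ and let $\mathcal{F}=\{\varphi_n\}_{n=1}^\infty$ be a sub-additive potential on $\mathcal{X}$. Then $$\mathrm{mdim}_H(\mathcal{X},T,d,\mathcal{F})\le\underline{\mathrm{mdim}}_M(\mathcal{X},T,d,\mathcal{F}).$$ If moreover $\mathcal{F}$ has bounded distortion and there exists $K>0$ such that $|\varphi_{n+1}-\varphi_n|<K$ on $\mathcal{X}$ for every $n$, then $$\mathrm{mdim}(\mathcal{X},T,\mathcal{F})\le\mathrm{mdim}_H(\mathcal{X},T,d,\mathcal{F}).$$
   Context: A dynamical system $(\mathcal{X},T)$ is a compact metrizable space $\mathcal{X}$ with a homeomorphism $T:\mathcal{X}\to\mathcal{X}$; metrics on $\mathcal{X}$ are compatible with the topology. For a metric $d$ and $N\ge1$, $d_N(x,y)=\max_{0\le n<N}d(T^nx,T^ny)$. Sub-additive potential: a sequence $\mathcal{F}=\{\varphi_n\}_{n\ge1}$ of continuous functions $\varphi_n:\mathcal{X}\to\mathbb{R}$ with $\varphi_{n+m}(x)\le\varphi_n(x)+\varphi_m(T^nx)$ for all $x\in\mathcal{X}$, $m,n\in\mathbb{N}$. Bounded distortion: with $\mathrm{var}_\epsilon(\varphi,d)=\sup\{|\varphi(x)-\varphi(y)|: d(x,y)<\epsilon\}$, $\mathcal{F}$ has bounded distortion if $\lim_{\epsilon\to0}\limsup_{n\to\infty}\mathrm{var}_\epsilon(\varphi_n,d_n)/n=0$. Mean dimension with potential: simplicial complexes are finite. For a simplicial complex $P$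 and $a\in P$, $\dim_aP$ is the maximum of $\dim\Delta$ over simplexes $\Delta\subset P$ containing $a$. A continuous map $f$ from a compact metric space $(\mathcal{X},d)$ to a topological space $\mathcal{Y}$ is an $\epsilon$-embedding if $\mathrm{diam}\,f^{-1}(y)<\epsilon$ for all $y\in\mathcal{Y}$. For continuous $\varphi:\mathcal{X}\to\mathbb{R}$, $$\mathrm{Widim}_\epsilon(\mathcal{X},d,\varphi)=\inf\Big\{\max_{x\in\mathcal{X}}(\dim_{f(x)}P+\varphi(x)) : P\text{ a simplicial complex},\ f:\mathcal{X}\to P\text{ an }\epsilon\text{-embedding}\Big\}.$$ Set $\mathrm{mdim}(\mathcal{X},T,\mathcal{F})=\lim_{\epsilon\to0}\left(\lim_{N\to\infty}\frac{\mathrm{Widim}_\epsilon(\mathcal{X},d_N,\varphi_N)}{N}\right)$; the value is independent of the choice of $d$. Lower metric mean dimension with potential: for continuous $\varphi:\mathcal{X}\to\mathbb{R}$ and $\epsilon>0$, $$\#(\mathcal{X},d,\varphi,\epsilon)=\inf\Big\{\sum_{i=1}^n(1/\epsilon)^{\sup_{U_i}\varphi} : \mathcal{X}=U_1\cup\dots\cup U_n\text{ an open cover with }\mathrm{diam}\,U_i<\epsilon\text{ for all }i\Big\},$$ $P(\mathcal{X},T,d,\mathcal{F},\epsilon)=\lim_{N\to\infty}\frac{\log\#(\mathcal{X},d_N,\varphi_N,\epsilon)}{N}$, and $\underline{\mathrm{mdim}}_M(\mathcal{X},T,d,\mathcal{F})=\liminf_{\epsilon\to0}\frac{P(\mathcal{X},T,d,\mathcal{F},\epsilon)}{\log(1/\epsilon)}$.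 Mean Hausdorff dimension with potential: for $\epsilon>0$, $s\ge\max_{\mathcal{X}}\varphi$, $$H^s_\epsilon(\mathcal{X},d,\varphi)=\inf\Big\{\sum_{i=1}^\infty(\mathrm{diam}\,E_i)^{s-\sup_{E_i}\varphi} : \mathcal{X}=\bigcup_{i=1}^\infty E_i,\ \mathrm{diam}\,E_i<\epsilon\ \forall i\ge1\Big\},$$ with the conventions $0^0=1$ and that terms with $E_i=\emptyset$ are $0$. $\dim_H(\mathcal{X},d,\varphi,\epsilon)$ is the supremum of $s\ge\max_{\mathcal{X}}\varphi$ with $H^s_\epsilon(\mathcal{X},d,\varphi)\ge1$. Set $\mathrm{mdim}_H(\mathcal{X},T,d,\mathcal{F})=\lim_{\epsilon\to0}\left(\limsup_{N\to\infty}\frac{\dim_H(\mathcal{X},d_N,\varphi_N,\epsilon)}{N}\right)$. *)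

theory Defs
  imports "HOL-Analysis.Analysis"
begin

section \<open>Dynamical systems, compatible metrics, potentials\<close>

definition dynamical_system :: "'a topology \<Rightarrow> ('a \<Rightarrow> 'a) \<Rightarrow> bool" where
  "dynamical_system X T \<longleftrightarrow>
     compact_space X \<and> metrizable_space X \<and> homeomorphic_map X X T"

definition compatible_metric :: "'a topology \<Rightarrow> ('a \<Rightarrow> 'a \<Rightarrow> real) \<Rightarrow> bool" where
  "compatible_metric X d \<longleftrightarrow>
     Metric_space (topspace X) d \<and> Metric_space.mtopology (topspace X) d = X"

text \<open>Only meant for \<open>N \<ge> 1\<close>.\<close>

definition dyn_metric :: "('a \<Rightarrow> 'a) \<Rightarrow> ('a \<Rightarrow> 'a \<Rightarrow> real) \<Rightarrow> nat \<Rightarrow> 'a \<Rightarrow> 'a \<Rightarrow> real" where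
  "dyn_metric T d N x y = Max ((\<lambda>n. d ((T ^^ n) x) ((T ^^ n) y)) ` {..<N})"

text \<open>The counterpart of \<^const>\<open>diameter\<close> for an explicitly given distance function.\<close>

definition diam :: "('a \<Rightarrow> 'a \<Rightarrow> real) \<Rightarrow> 'a set \<Rightarrow> real" where
  "diam d S = (if S = {} then 0 else SUP (x, y) \<in> S \<times> S. d x y)"

text \<open>A potential is a sequence indexed by \<open>n \<ge> 1\<close>; the value at index \<open>0\<close> is never constrained.\<close>

definition subadditive_potential ::
  "'a topology \<Rightarrow> ('a \<Rightarrow> 'a) \<Rightarrow> (nat \<Rightarrow> 'a \<Rightarrow> real) \<Rightarrow> bool" where
  "subadditive_potential X T \<phi> \<longleftrightarrow>
     (\<forall>n\<ge>1. continuous_map X euclideanreal (\<phi> n)) \<and>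
     (\<forall>n\<ge>1. \<forall>m\<ge>1. \<forall>x\<in>topspace X. \<phi> (n + m) x \<le> \<phi> n x + \<phi> m ((T ^^ n) x))"

definition variation ::
  "'a topology \<Rightarrow> real \<Rightarrow> ('a \<Rightarrow> real) \<Rightarrow> ('a \<Rightarrow> 'a \<Rightarrow> real) \<Rightarrow> real" where
  "variation X \<epsilon> \<phi> d =
     Sup {\<bar>\<phi> x - \<phi> y\<bar> | x y. x \<in> topspace X \<and> y \<in> topspace X \<and> d x y < \<epsilon>}"

definition bounded_distortion ::
  "'a topology \<Rightarrow> ('a \<Rightarrow> 'a) \<Rightarrow> ('a \<Rightarrow> 'a \<Rightarrow> real) \<Rightarrow> (nat \<Rightarrow> 'a \<Rightarrow> real) \<Rightarrow> bool" where
  "bounded_distortion X T d \<phi> \<longleftrightarrow>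
     ((\<lambda>\<epsilon>. limsup (\<lambda>n. ereal (variation X \<epsilon> (\<phi> n) (dyn_metric T d n) / real n)))
        \<longlongrightarrow> 0) (at_right 0)"

section \<open>Mean dimension with potential\<close>

text \<open>
  The type of \<^const>\<open>simplicial_complex\<close> fixes the dimension of the ambient space, whereas the
  infimum below runs over complexes of all dimensions.  Finite simplicial complexes are
  therefore given by their combinatorial data (a finite family of nonempty finite sets of
  vertices in \<^typ>\<open>nat\<close>, closed under nonempty subsets) together with the standard geometric
  realization by barycentric coordinates.  Every finite simplicial complex is isomorphic
  to one of these.
\<close>

definition finite_complex :: "nat set set \<Rightarrow> bool" where
  "finite_complex K \<longleftrightarrow> finite K \<and>
     (\<forall>s\<in>K. finite s \<and> s \<noteq> {}) \<and>
     (\<forall>s\<in>K. \<forall>t. t \<subseteq> s \<and> t \<noteq> {} \<longrightarrow> t \<in> K)"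

definition closed_simplex :: "nat set \<Rightarrow> (nat \<Rightarrow> real) set" where
  "closed_simplex s = {a. (\<forall>v. 0 \<le> a v) \<and> (\<forall>v. v \<notin> s \<longrightarrow> a v = 0) \<and> (\<Sum>v\<in>s. a v) = 1}"

definition polyhedron_of :: "nat set set \<Rightarrow> (nat \<Rightarrow> real) set" where
  "polyhedron_of K = (\<Union>s\<in>K. closed_simplex s)"

text \<open>
  All points of the realization vanish outside one finite set of coordinates, so the product
  topology induces on it the usual (Euclidean) topology.
\<close>

definition polyhedron_top :: "nat set set \<Rightarrow> (nat \<Rightarrow> real) topology" where
  "polyhedron_top K = subtopology (powertop_real UNIV) (polyhedron_of K)"

definition local_dim :: "nat set set \<Rightarrow> (nat \<Rightarrow> real) \<Rightarrow> nat" where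
  "local_dim K a = Max {card s - 1 | s. s \<in> K \<and> a \<in> closed_simplex s}"

definition eps_embedding ::
  "'a topology \<Rightarrow> ('a \<Rightarrow> 'a \<Rightarrow> real) \<Rightarrow> real \<Rightarrow> 'b topology \<Rightarrow> ('a \<Rightarrow> 'b) \<Rightarrow> bool" where
  "eps_embedding X d \<epsilon> Y f \<longleftrightarrow> continuous_map X Y f \<and>
     (\<forall>y\<in>topspace Y. diam d {x \<in> topspace X. f x = y} < \<epsilon>)"

text \<open>
  The supremum over \<open>x\<close> is attained for nonempty \<open>X\<close>: the local dimension is upper
  semicontinuous.
\<close>

definition Widim ::
  "'a topology \<Rightarrow> ('a \<Rightarrow> 'a \<Rightarrow> real) \<Rightarrow> ('a \<Rightarrow> real) \<Rightarrow> real \<Rightarrow> ereal" where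
  "Widim X d \<phi> \<epsilon> =
     Inf {SUP x \<in> topspace X. ereal (real (local_dim K (f x)) + \<phi> x) | K f.
            finite_complex K \<and> eps_embedding X d \<epsilon> (polyhedron_top K) f}"

text \<open>
  The limits below are taken in \<^typ>\<open>ereal\<close>, as a sub-additive potential may produce the
  value \<open>-\<infinity>\<close>.  For a dynamical system with a compatible metric and a sub-additive potential
  they exist: the limits in \<open>N\<close> by sub-additivity (for the cover numbers if \<open>\<epsilon> < 1\<close>),
  those in \<open>\<epsilon>\<close> by monotonicity.  The value of \<open>mdim\<close> is the same for all compatible
  metrics \<open>d\<close>.
\<close>

definition mdim ::
  "'a topology \<Rightarrow> ('a \<Rightarrow> 'a) \<Rightarrow> ('a \<Rightarrow> 'a \<Rightarrow> real) \<Rightarrow> (nat \<Rightarrow> 'a \<Rightarrow> real) \<Rightarrow> ereal" where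
  "mdim X T d \<phi> =
     Lim (at_right 0) (\<lambda>\<epsilon>. lim (\<lambda>N. Widim X (dyn_metric T d N) (\<phi> N) \<epsilon> / ereal (real N)))"

section \<open>Lower metric mean dimension with potential\<close>

text \<open>Empty members of a cover contribute \<open>0\<close>, in accordance with \<open>sup \<emptyset> = -\<infinity>\<close>.\<close>

definition cover_number ::
  "'a topology \<Rightarrow> ('a \<Rightarrow> 'a \<Rightarrow> real) \<Rightarrow> ('a \<Rightarrow> real) \<Rightarrow> real \<Rightarrow> real" where
  "cover_number X d \<phi> \<epsilon> =
     Inf {\<Sum>i<n. if U i = {} then 0 else (1 / \<epsilon>) powr (SUP x \<in> U i. \<phi> x) | (n :: nat) U.
            (\<forall>i<n. openin X (U i) \<and> diam d (U i) < \<epsilon>) \<and> (\<Union>i<n. U i) = topspace X}"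

definition eps_pressure ::
  "'a topology \<Rightarrow> ('a \<Rightarrow> 'a) \<Rightarrow> ('a \<Rightarrow> 'a \<Rightarrow> real) \<Rightarrow> (nat \<Rightarrow> 'a \<Rightarrow> real) \<Rightarrow> real \<Rightarrow> ereal" where
  "eps_pressure X T d \<phi> \<epsilon> =
     lim (\<lambda>N. ereal (ln (cover_number X (dyn_metric T d N) (\<phi> N) \<epsilon>) / real N))"

definition lower_mdim_M ::
  "'a topology \<Rightarrow> ('a \<Rightarrow> 'a) \<Rightarrow> ('a \<Rightarrow> 'a \<Rightarrow> real) \<Rightarrow> (nat \<Rightarrow> 'a \<Rightarrow> real) \<Rightarrow> ereal" where
  "lower_mdim_M X T d \<phi> =
     Liminf (at_right 0) (\<lambda>\<epsilon>. eps_pressure X T d \<phi> \<epsilon> / ereal (ln (1 / \<epsilon>)))"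

section \<open>Mean Hausdorff dimension with potential\<close>

text \<open>\<^const>\<open>powr\<close> has \<open>0 powr 0 = 0\<close>, whereas here \<open>0\<^sup>0 = 1\<close> is required.\<close>

definition hausdorff_term ::
  "('a \<Rightarrow> 'a \<Rightarrow> real) \<Rightarrow> ('a \<Rightarrow> real) \<Rightarrow> real \<Rightarrow> 'a set \<Rightarrow> real" where
  "hausdorff_term d \<phi> s E =
     (if E = {} then 0
      else if diam d E = 0 \<and> s - (SUP x \<in> E. \<phi> x) = 0 then 1
      else diam d E powr (s - (SUP x \<in> E. \<phi> x)))"

definition hausdorff_content ::
  "'a topology \<Rightarrow> ('a \<Rightarrow> 'a \<Rightarrow> real) \<Rightarrow> ('a \<Rightarrow> real) \<Rightarrow> real \<Rightarrow> real \<Rightarrow> ennreal" where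
  "hausdorff_content X d \<phi> \<epsilon> s =
     Inf {\<Sum>i. ennreal (hausdorff_term d \<phi> s (E i)) | E :: nat \<Rightarrow> 'a set.
            (\<Union>i. E i) = topspace X \<and> (\<forall>i. diam d (E i) < \<epsilon>)}"

definition dim_H ::
  "'a topology \<Rightarrow> ('a \<Rightarrow> 'a \<Rightarrow> real) \<Rightarrow> ('a \<Rightarrow> real) \<Rightarrow> real \<Rightarrow> ereal" where
  "dim_H X d \<phi> \<epsilon> =
     Sup {ereal s | s. (SUP x \<in> topspace X. \<phi> x) \<le> s \<and> hausdorff_content X d \<phi> \<epsilon> s \<ge> 1}"

definition mdim_H ::
  "'a topology \<Rightarrow> ('a \<Rightarrow> 'a) \<Rightarrow> ('a \<Rightarrow> 'a \<Rightarrow> real) \<Rightarrow> (nat \<Rightarrow> 'a \<Rightarrow> real) \<Rightarrow> ereal" where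
  "mdim_H X T d \<phi> =
     Lim (at_right 0)
       (\<lambda>\<epsilon>. limsup (\<lambda>N. dim_H X (dyn_metric T d N) (\<phi> N) \<epsilon> / ereal (real N)))"

end

theory Submission
  imports Defs
begin

text \<open>
  Write \<open>d\<^sub>N\<close> for the Bowen metrics \<open>dyn_metric T d N\<close>.

  The first inequality holds scale by scale.  In an open cover by sets of diameter less than
  \<open>\<epsilon> < 1\<close> every diameter may be replaced by \<open>\<epsilon>\<close>, so the Hausdorff sum with exponent \<open>s\<close> is at most
  \<open>\<epsilon>\<close> to the power \<open>s\<close> times the covering sum.  Hence \<open>dim_H\<close> is at most the logarithm of the covering
  number divided by \<open>ln (1 / \<epsilon>)\<close> (lemma \<open>dim_H_le_cover_number\<close>).  Dividing by \<open>N\<close> and passing to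
  the limits gives the claim, once the limit over \<open>N\<close> of the covering numbers is known to exist;
  this is Fekete's lemma, because covering numbers are submultiplicative.

  For the second inequality, fix a scale \<open>\<eta>\<close> and a finite net \<open>P\<close>.  Cut-off functions around the
  points of \<open>P\<close>, evaluated along orbits of length \<open>N\<close>, map \<open>X\<close> to a cube with \<open>N * card P\<close>
  coordinates.  The map is Lipschitz for \<open>d\<^sub>N\<close> with a constant independent of \<open>N\<close>, and two points
  at \<open>d\<^sub>N\<close>-distance at least \<open>\<eta>\<close> have some coordinate at which one has the value 1 and the other 0.
  Take a cover by sets of diameter less than \<open>\<delta>\<close> with Hausdorff sum less than 1 for an exponent
  \<open>s\<close>.  Let a point \<open>t\<close> of the cube be random.  The event that the image of a member \<open>E\<close> of the cover
  meets \<open>t\<close> in \<open>m\<close> coordinates has probability at most \<open>C ^ N * (diam E) ^ m\<close>, with \<open>C\<close> depending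
  only on \<open>\<eta>\<close> and \<open>P\<close>.  If \<open>m\<close> is at least \<open>s + \<tau> * N - sup \<phi>\<^sub>N\<close>, the sup being over \<open>E\<close>, then the extra
  exponent \<open>\<tau> * N\<close> absorbs \<open>C ^ N\<close> as soon as \<open>\<delta>\<close> is small in terms of \<open>C\<close> and \<open>\<tau>\<close>, uniformly in
  \<open>N\<close>.  So some \<open>t\<close> meets the image of every \<open>x\<close> in fewer than \<open>s + \<tau> * N - \<phi>\<^sub>N x\<close> coordinates
  (lemma \<open>point_avoiding_boxes\<close>).

  Stretching every coordinate around \<open>t\<close> then pushes the image of \<open>x\<close> to a face of the cube of
  dimension less than \<open>s + \<tau> * N - \<phi>\<^sub>N x\<close>.  Distant points still lie on opposite facets, so points
  whose images share a closed face are \<open>\<eta>\<close>-close and their potentials differ by at most the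
  variation.  This bounds the local dimension at \<open>x\<close> plus \<open>\<phi>\<^sub>N x\<close> (lemmas
  \<open>Widim_le_of_separating_functions\<close> and \<open>Widim_le_dim_H\<close>):
  the width dimension is at most \<open>dim_H + \<tau> * N\<close> plus the variation, and bounded distortion makes
  the variation at most \<open>\<tau> * N\<close> for small \<open>\<eta>\<close> and large \<open>N\<close>.  A second compatible metric \<open>d'\<close> only
  affects how small \<open>\<eta>\<close> has to be, by uniform continuity of the identity.

  The limit over \<open>N\<close> in the mean dimension exists because the width dimension is subadditive.
  This needs a triangulation of a product of two complexes whose local dimensions are at most the
  sums of those of the factors; the monotone coupling of two barycentric coordinate vectors
  provides it (lemma \<open>Widim_product\<close>).
\<close>

section \<open>Limits of subadditive and of antitone families\<close>

text \<open>
  Fekete's lemma.  The limit is taken in the extended reals because the averages of a potential may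
  tend to \<open>-\<infinity>\<close>.
\<close>

lemma fekete_ereal:
  fixes a :: "nat \<Rightarrow> real"
  assumes sub: "\<And>m n. 1 \<le> m \<Longrightarrow> 1 \<le> n \<Longrightarrow> a (m + n) \<le> a m + a n"
  shows "(\<lambda>n. ereal (a n / real n)) \<longlonglongrightarrow> (INF n\<in>{1..}. ereal (a n / real n))"
proof (rule order_tendstoI)
  fix y assume "y < (INF n\<in>{1..}. ereal (a n / real n))"
  then show "\<forall>\<^sub>F n in sequentially. y < ereal (a n / real n)"
    by (intro eventually_sequentiallyI[of 1]) (auto elim: less_le_trans intro!: INF_lower)
next
  fix y assume "(INF n\<in>{1..}. ereal (a n / real n)) < y"
  then obtain m where m: "1 \<le> m" "ereal (a m / real m) < y"
    by (auto simp: INF_less_iff)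
  obtain b where b: "ereal (a m / real m) < ereal b" "ereal b < y"
    using ereal_dense2[OF m(2)] by blast
  define C where "C = (\<Sum>r\<le>m. \<bar>a r\<bar>)"
  have C: "a r \<le> C" if "r \<le> m" for r
  proof -
    have "\<bar>a r\<bar> \<le> C" unfolding C_def using that by (intro member_le_sum) auto
    then show ?thesis by linarith
  qed
  have mult: "a (q * m + r) \<le> real q * a m + a r" if "1 \<le> r" for q r
  proof (induction q)
    case (Suc q)
    have "a (m + (q * m + r)) \<le> a m + a (q * m + r)"
      using m that by (intro sub) auto
    with Suc show ?case by (simp add: algebra_simps)
  qed simp
  \<comment> \<open>Dividing \<open>n - 1\<close> rather than \<open>n\<close> by \<open>m\<close> keeps the remainder \<open>r\<close> positive: nothing is known
    about \<open>a 0\<close>.\<close>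
  have bound: "a n / real n \<le> a m / real m + (C + \<bar>a m\<bar>) / real n" if n: "1 \<le> n" for n
  proof -
    define q r where "q = (n - 1) div m" and "r = (n - 1) mod m + 1"
    have nqr: "n = q * m + r"
      using n div_mult_mod_eq[of "n - 1" m] by (simp add: q_def r_def)
    have r: "1 \<le> r" "r \<le> m"
      unfolding r_def using m by (auto simp: Suc_le_eq)
    have "a n \<le> real q * a m + C"
      using mult[OF r(1), of q] C[OF r(2)] nqr by simp
    also have "real q * a m = real n * (a m / real m) - real r / real m * a m"
      using m(1) by (simp add: nqr field_simps)
    also have "\<dots> \<le> real n * (a m / real m) + \<bar>a m\<bar>"
    proof -
      have "\<bar>real r / real m * a m\<bar> \<le> 1 * \<bar>a m\<bar>"
        unfolding abs_mult using r m by (intro mult_right_mono) auto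
      then show ?thesis by linarith
    qed
    finally show ?thesis using n by (simp add: field_simps)
  qed
  have "(\<lambda>n. a m / real m + (C + \<bar>a m\<bar>) / real n) \<longlonglongrightarrow> a m / real m + 0"
    by (intro tendsto_intros lim_const_over_n)
  then have "\<forall>\<^sub>F n in sequentially. a m / real m + (C + \<bar>a m\<bar>) / real n < b"
    using b(1) by (intro order_tendstoD(2)) auto
  then show "\<forall>\<^sub>F n in sequentially. ereal (a n / real n) < y"
    using eventually_ge_at_top[of 1]
  proof eventually_elim
    case (elim n)
    then have "a n / real n < b" using bound[of n] by linarith
    then have "ereal (a n / real n) < ereal b" by simp
    then show ?case using b(2) by (rule less_trans)
  qed
qed

lemma tendsto_SUP_at_right_0:
  fixes h :: "real \<Rightarrow> ereal"
  assumes anti: "\<And>x y. 0 < x \<Longrightarrow> x \<le> y \<Longrightarrow> h y \<le> h x"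
  shows "(h \<longlongrightarrow> (SUP x\<in>{0<..}. h x)) (at_right 0)"
proof (rule order_tendstoI)
  fix z assume "z < (SUP x\<in>{0<..}. h x)"
  then obtain x where x: "0 < x" "z < h x" by (auto simp: less_SUP_iff)
  then show "\<forall>\<^sub>F t in at_right 0. z < h t"
    using anti by (intro eventually_at_rightI[of 0 x]) (auto intro: less_le_trans)
next
  fix z assume "(SUP x\<in>{0<..}. h x) < z"
  then show "\<forall>\<^sub>F t in at_right 0. h t < z"
    by (intro eventually_at_rightI[of 0 1]) (auto elim!: le_less_trans[rotated] intro!: SUP_upper)
qed

section \<open>Diameters and Bowen metrics\<close>

lemma diam_empty [simp]: "diam d {} = 0"
  by (simp add: diam_def)

lemma diam_le:
  assumes "\<And>x y. x \<in> S \<Longrightarrow> y \<in> S \<Longrightarrow> d x y \<le> c" "S = {} \<Longrightarrow> 0 \<le> c"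
  shows "diam d S \<le> c"
  using assms unfolding diam_def by (auto intro!: cSUP_least)

lemma le_diam:
  assumes "\<And>x y. x \<in> S \<Longrightarrow> y \<in> S \<Longrightarrow> d x y \<le> B" "x \<in> S" "y \<in> S"
  shows "d x y \<le> diam d S"
proof -
  have "bdd_above ((\<lambda>(x, y). d x y) ` (S \<times> S))"
    using assms(1) by (auto intro!: bdd_aboveI[of _ B])
  from cSUP_upper[OF _ this, of "(x, y)"] assms(2,3) show ?thesis
    unfolding diam_def by auto
qed

lemma dyn_metric_1: "dyn_metric T d 1 = d"
  by (simp add: dyn_metric_def lessThan_Suc fun_eq_iff)

lemma dyn_metric_le_iff:
  assumes "1 \<le> N"
  shows "dyn_metric T d N x y \<le> c \<longleftrightarrow> (\<forall>n<N. d ((T ^^ n) x) ((T ^^ n) y) \<le> c)"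
proof -
  have "{..<N} \<noteq> {}" using assms by (auto simp: lessThan_empty_iff)
  then show ?thesis unfolding dyn_metric_def by (auto simp: Max_le_iff)
qed

lemma dyn_metric_less_iff:
  assumes "1 \<le> N"
  shows "dyn_metric T d N x y < c \<longleftrightarrow> (\<forall>n<N. d ((T ^^ n) x) ((T ^^ n) y) < c)"
proof -
  have "{..<N} \<noteq> {}" using assms by (auto simp: lessThan_empty_iff)
  then show ?thesis unfolding dyn_metric_def by (auto simp: Max_less_iff)
qed

lemma dyn_metric_add:
  assumes "1 \<le> N" "1 \<le> M"
  shows "dyn_metric T d (N + M) x y =
    max (dyn_metric T d N x y) (dyn_metric T d M ((T ^^ N) x) ((T ^^ N) y))"
proof -
  have *: "(\<forall>n<N + M. P n) \<longleftrightarrow> (\<forall>n<N. P n) \<and> (\<forall>n<M. P (n + N))" for P :: "nat \<Rightarrow> bool"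
  proof (intro iffI conjI allI impI; (elim conjE)?)
    fix n assume "\<forall>n<N. P n" "\<forall>n<M. P (n + N)" "n < N + M"
    then show "P n"
      by (metis add.commute add_less_cancel_right le_add_diff_inverse2 not_le)
  qed auto
  have "dyn_metric T d (N + M) x y \<le> c \<longleftrightarrow>
    max (dyn_metric T d N x y) (dyn_metric T d M ((T ^^ N) x) ((T ^^ N) y)) \<le> c" for c
    using assms by (simp add: dyn_metric_le_iff * funpow_add)
  then show ?thesis by (meson order_antisym order_refl)
qed

section \<open>Width dimension from partitions of unity\<close>

text \<open>
  A partition of unity \<open>w\<close> indexed by a finite set is a map to a simplex.  Its image lies in the
  complex that consists of all faces of the supports of its values, and the faces that contain the
  image of \<open>x\<close> are the sets between the support at \<open>x\<close> and the support at some \<open>y\<close>.  A bound for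
  the size of such sets therefore bounds the local dimension.  All \<epsilon>-embeddings below are
  obtained in this way.
\<close>

lemma Widim_le_of_weights:
  fixes w :: "'a \<Rightarrow> 'v \<Rightarrow> real"
  assumes fin: "finite V" and eps: "0 < \<epsilon>"
    and cont: "\<And>v. v \<in> V \<Longrightarrow> continuous_map X euclideanreal (\<lambda>x. w x v)"
    and nonneg: "\<And>x v. x \<in> topspace X \<Longrightarrow> v \<in> V \<Longrightarrow> 0 \<le> w x v"
    and sum1: "\<And>x. x \<in> topspace X \<Longrightarrow> (\<Sum>v\<in>V. w x v) = 1"
    and fib: "\<And>x. x \<in> topspace X \<Longrightarrow>
        diam d {y \<in> topspace X. \<forall>v\<in>V. w y v = w x v} < \<epsilon>"
    and dim: "\<And>x y s. x \<in> topspace X \<Longrightarrow> y \<in> topspace X \<Longrightarrow>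
        {v \<in> V. 0 < w x v} \<subseteq> s \<Longrightarrow> s \<subseteq> {v \<in> V. 0 < w y v} \<Longrightarrow> s \<noteq> {} \<Longrightarrow>
        real (card s - 1) + \<phi> x \<le> c"
  shows "Widim X d \<phi> \<epsilon> \<le> ereal c"
proof -
  define supp where "supp x = {v \<in> V. 0 < w x v}" for x
  \<comment> \<open>Vertices of a complex are natural numbers, so the index set is renumbered by \<open>e\<close>.\<close>
  obtain e :: "'v \<Rightarrow> nat" where e: "inj_on e V"
    using finite_imp_inj_to_nat_seg[OF fin] by auto
  define f where "f x k = (if k \<in> e ` V then w x (inv_into V e k) else 0)" for x k
  define K where "K = {e ` s | s. s \<noteq> {} \<and> (\<exists>x\<in>topspace X. s \<subseteq> supp x)}"
  have supp_V: "supp x \<subseteq> V" for x by (auto simp: supp_def)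
  have f_e: "f x (e v) = w x v" if "v \<in> V" for x v
    using that e by (simp add: f_def inv_into_f_f)
  have supp_ne: "supp x \<noteq> {}" if x: "x \<in> topspace X" for x
  proof
    assume "supp x = {}"
    then have "w x v = 0" if "v \<in> V" for v
      using nonneg[OF x that] that by (force simp: supp_def)
    then have "(\<Sum>v\<in>V. w x v) = 0" by simp
    then show False using sum1[OF x] by simp
  qed
  have K_fin: "finite_complex K"
    unfolding finite_complex_def
  proof (intro conjI ballI allI impI)
    have "K \<subseteq> Pow (e ` V)" using supp_V unfolding K_def by blast
    then show "finite K" using fin by (meson finite_Pow_iff finite_imageI finite_subset)
  next
    fix s assume "s \<in> K"
    then show "finite s" "s \<noteq> {}"
      unfolding K_def using supp_V fin by (blast intro: finite_subset)+
  next
    fix s t assume "s \<in> K" and t: "t \<subseteq> s \<and> t \<noteq> {}"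
    then obtain r x where r: "s = e ` r" "x \<in> topspace X" "r \<subseteq> supp x"
      unfolding K_def by blast
    obtain q where "q \<subseteq> r" "t = e ` q" using t r(1) by (auto simp: subset_image_iff)
    with t r show "t \<in> K" unfolding K_def by blast
  qed
  have in_simplex: "f x \<in> closed_simplex (e ` s) \<longleftrightarrow> supp x \<subseteq> s"
    if x: "x \<in> topspace X" and s: "s \<subseteq> V" for x s
  proof
    assume L: "f x \<in> closed_simplex (e ` s)"
    show "supp x \<subseteq> s"
    proof
      fix v assume v: "v \<in> supp x"
      then have "f x (e v) > 0" using supp_V f_e by (auto simp: supp_def)
      then have "e v \<in> e ` s" using L unfolding closed_simplex_def by force
      then show "v \<in> s" using e v s supp_V by (meson inj_on_image_mem_iff subsetD)
    qed
  next
    assume sub: "supp x \<subseteq> s"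
    have "f x k = 0" if "k \<notin> e ` s" for k
    proof (cases "k \<in> e ` V")
      case True
      then obtain v where v: "v \<in> V" "k = e v" by auto
      with that sub have "v \<notin> supp x" by auto
      then show ?thesis using nonneg[OF x v(1)] v by (auto simp: supp_def f_e)
    qed (simp add: f_def)
    moreover have "0 \<le> f x k" for k
      using nonneg[OF x] by (auto simp: f_def inv_into_into)
    moreover have "(\<Sum>k\<in>e ` s. f x k) = 1"
    proof -
      have "(\<Sum>k\<in>e ` s. f x k) = (\<Sum>v\<in>s. f x (e v))"
        by (rule sum.reindex_cong[of e]) (use e s inj_on_subset in auto)
      also have "\<dots> = (\<Sum>v\<in>s. w x v)"
        using s f_e by (intro sum.cong) auto
      also have "\<dots> = (\<Sum>v\<in>V. w x v)"
        using fin s sub nonneg[OF x]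
        by (intro sum.mono_neutral_left) (force simp: supp_def)+
      finally show ?thesis using sum1[OF x] by simp
    qed
    ultimately show "f x \<in> closed_simplex (e ` s)" unfolding closed_simplex_def by blast
  qed
  have f_in: "f x \<in> polyhedron_of K" if x: "x \<in> topspace X" for x
  proof -
    have "e ` supp x \<in> K" using x supp_ne unfolding K_def by blast
    moreover have "f x \<in> closed_simplex (e ` supp x)" using in_simplex[OF x supp_V] by blast
    ultimately show ?thesis unfolding polyhedron_of_def by blast
  qed
  have "continuous_map X euclideanreal (\<lambda>x. f x k)" for k
    by (cases "k \<in> e ` V") (simp_all add: f_def cont inv_into_into)
  then have "continuous_map X (powertop_real UNIV) f"
    by (simp add: continuous_map_componentwise_UNIV)
  then have f_cont: "continuous_map X (polyhedron_top K) f"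
    unfolding polyhedron_top_def using f_in by (auto simp: continuous_map_in_subtopology)
  have "diam d {x \<in> topspace X. f x = y} < \<epsilon>" for y
  proof (cases "\<exists>x\<in>topspace X. f x = y")
    case True
    then obtain x where x: "x \<in> topspace X" "f x = y" by blast
    have "f z = f x \<longleftrightarrow> (\<forall>v\<in>V. w z v = w x v)" for z
    proof
      assume "f z = f x" then show "\<forall>v\<in>V. w z v = w x v" using f_e by metis
    qed (auto simp: f_def inv_into_into fun_eq_iff)
    then show ?thesis using fib[OF x(1)] x(2) by auto
  next
    case False
    then have "{x \<in> topspace X. f x = y} = {}" by blast
    then show ?thesis using eps by (simp add: diam_def)
  qed
  then have emb: "eps_embedding X d \<epsilon> (polyhedron_top K) f"
    unfolding eps_embedding_def using f_cont by blast
  have loc: "real (local_dim K (f x)) + \<phi> x \<le> c" if x: "x \<in> topspace X" for x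
  proof -
    let ?A = "{card s - 1 | s. s \<in> K \<and> f x \<in> closed_simplex s}"
    have "finite ?A" using K_fin unfolding finite_complex_def by auto
    moreover have "?A \<noteq> {}" using f_in[OF x] unfolding polyhedron_of_def by auto
    ultimately have "local_dim K (f x) \<in> ?A" unfolding local_dim_def by (rule Max_in)
    then obtain s' where s': "local_dim K (f x) = card s' - 1" "s' \<in> K" "f x \<in> closed_simplex s'"
      by blast
    then obtain s y where s: "s' = e ` s" "s \<noteq> {}" "y \<in> topspace X" "s \<subseteq> supp y"
      unfolding K_def by blast
    have sV: "s \<subseteq> V" using s supp_V by blast
    have "card s' = card s" unfolding s(1) using e sV by (meson card_image inj_on_subset)
    moreover have "supp x \<subseteq> s" using in_simplex[OF x sV] s' s by blast
    ultimately show ?thesis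
      using dim[OF x s(3), of s] s s'(1) by (simp add: supp_def)
  qed
  have "Widim X d \<phi> \<epsilon> \<le> (SUP x \<in> topspace X. ereal (real (local_dim K (f x)) + \<phi> x))"
    unfolding Widim_def using K_fin emb by (intro Inf_lower) blast
  also have "\<dots> \<le> ereal c" using loc by (intro SUP_least) simp
  finally show ?thesis .
qed

text \<open>
  The map that sends a pair to the sum of the ranks of its coordinates is strictly increasing
  along a chain of the product order.
\<close>

lemma card_chain_prod:
  fixes s :: "(nat \<times> nat) set"
  assumes fin: "finite s" and ne: "s \<noteq> {}"
    and chain: "\<And>p q. p \<in> s \<Longrightarrow> q \<in> s \<Longrightarrow> fst p < fst q \<Longrightarrow> snd p \<le> snd q"
  shows "card s + 1 \<le> card (fst ` s) + card (snd ` s)"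
proof -
  define h where "h A k = card {j \<in> A. j < k}" for A :: "nat set" and k
  have h_mono: "h A j \<le> h A k" if "finite A" "j \<le> k" for A j k
    unfolding h_def using that by (intro card_mono) auto
  have h_strict: "h A j < h A k" if "finite A" "j \<in> A" "j < k" for A j k
    unfolding h_def using that by (intro psubset_card_mono) auto
  have h_less: "h A k < card A" if "finite A" "k \<in> A" for A k
    unfolding h_def using that by (intro psubset_card_mono) auto
  define \<rho> where "\<rho> p = h (fst ` s) (fst p) + h (snd ` s) (snd p)" for p
  have fins: "finite (fst ` s)" "finite (snd ` s)" using fin by auto
  have less: "\<rho> p < \<rho> q" if "p \<in> s" "q \<in> s" "fst p < fst q \<or> fst p = fst q \<and> snd p < snd q" for p q
    using that(3)
  proof
    assume "fst p < fst q"
    then show ?thesis unfolding \<rho>_def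
      using h_strict[OF fins(1), of "fst p" "fst q"] h_mono[OF fins(2) chain[OF that(1,2)]] that by force
  next
    assume "fst p = fst q \<and> snd p < snd q"
    then show ?thesis unfolding \<rho>_def
      using h_strict[OF fins(2), of "snd p" "snd q"] that by force
  qed
  have inj: "inj_on \<rho> s"
  proof (rule inj_onI, rule ccontr)
    fix p q assume pq: "p \<in> s" "q \<in> s" "\<rho> p = \<rho> q" "p \<noteq> q"
    then consider "fst p < fst q \<or> fst p = fst q \<and> snd p < snd q"
      | "fst q < fst p \<or> fst q = fst p \<and> snd q < snd p"
      by (metis linorder_neqE_nat prod_eqI)
    then show False using less pq by (metis less_irrefl)
  qed
  have "\<rho> p < card (fst ` s) + card (snd ` s) - 1" if "p \<in> s" for p
    using h_less[OF fins(1), of "fst p"] h_less[OF fins(2), of "snd p"] that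
    unfolding \<rho>_def by force
  then have "\<rho> ` s \<subseteq> {..<card (fst ` s) + card (snd ` s) - 1}" by auto
  from card_mono[OF _ this] have "card s \<le> card (fst ` s) + card (snd ` s) - 1"
    by (simp add: card_image[OF inj])
  moreover have "0 < card (fst ` s)" using fins ne by (simp add: card_gt_0_iff)
  ultimately show ?thesis by linarith
qed

section \<open>Products of complexes\<close>

lemma polyhedron_of_points:
  assumes "a \<in> polyhedron_of K" "finite_complex K" "\<Union>K \<subseteq> {..<n}"
  shows "0 \<le> a u" "n \<le> u \<Longrightarrow> a u = 0" "(\<Sum>u<n. a u) = 1"
    and "\<exists>s\<in>K. {u. 0 < a u} \<subseteq> s"
proof -
  obtain s where s: "s \<in> K" "a \<in> closed_simplex s"
    using assms(1) unfolding polyhedron_of_def by blast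
  then have sn: "s \<subseteq> {..<n}" using assms(3) by blast
  show "0 \<le> a u" and "n \<le> u \<Longrightarrow> a u = 0"
    using s(2) sn unfolding closed_simplex_def by auto
  have "(\<Sum>u<n. a u) = (\<Sum>u\<in>s. a u)"
    using s(2) sn by (intro sum.mono_neutral_right) (auto simp: closed_simplex_def)
  then show "(\<Sum>u<n. a u) = 1" using s(2) by (simp add: closed_simplex_def)
  show "\<exists>s\<in>K. {u. 0 < a u} \<subseteq> s"
  proof (intro bexI[of _ s] subsetI)
    fix u assume "u \<in> {u. 0 < a u}"
    then have "a u \<noteq> 0" by simp
    moreover have "\<forall>v. v \<notin> s \<longrightarrow> a v = 0" using s(2) by (simp add: closed_simplex_def)
    ultimately show "u \<in> s" by blast
  qed (rule s(1))
qed

lemma local_dim_ge: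
  assumes "finite_complex K" "a \<in> polyhedron_of K" "s \<in> K" "{u. 0 < a u} \<subseteq> s"
  shows "card s - 1 \<le> local_dim K a"
proof -
  obtain r where r: "r \<in> K" "a \<in> closed_simplex r"
    using assms(2) unfolding polyhedron_of_def by blast
  have fin: "finite r" "finite s" "finite K"
    using r(1) assms(1,3) unfolding finite_complex_def by blast+
  have zero: "a u = 0" if "u \<notin> s" for u
    using that assms(4) r(2) unfolding closed_simplex_def
    by (metis (mono_tags, lifting) mem_Collect_eq order_le_less subsetD)
  have "(\<Sum>u\<in>s. a u) = (\<Sum>u\<in>r \<inter> s. a u)"
    using r fin by (intro sum.mono_neutral_right) (auto simp: closed_simplex_def)
  also have "\<dots> = (\<Sum>u\<in>r. a u)"
    using zero fin by (intro sum.mono_neutral_left) auto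
  finally have "a \<in> closed_simplex s"
    using r(2) zero unfolding closed_simplex_def by auto
  then show ?thesis
    unfolding local_dim_def using assms(3) fin by (intro Max_ge) auto
qed

text \<open>
  For two probability vectors \<open>a\<close> and \<open>b\<close>, cut the unit interval into consecutive pieces of lengths
  \<open>a 0, a 1, \<dots>\<close>, and also into pieces of lengths \<open>b 0, b 1, \<dots>\<close>.  The value at \<open>(u, v)\<close> is the length of
  the intersection of the \<open>u\<close>-th piece of the first kind with the \<open>v\<close>-th piece of the second kind.
  This is the monotone coupling of \<open>a\<close> and \<open>b\<close>; the formula is the mass that the joint distribution
  function, the minimum of the two distribution functions, gives to a rectangle.
\<close>

definition overlap :: "(nat \<Rightarrow> real) \<Rightarrow> (nat \<Rightarrow> real) \<Rightarrow> nat \<times> nat \<Rightarrow> real" where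
  "overlap a b = (\<lambda>(u, v).
     min (\<Sum>i<Suc u. a i) (\<Sum>j<Suc v. b j) - min (\<Sum>i<u. a i) (\<Sum>j<Suc v. b j)
     - min (\<Sum>i<Suc u. a i) (\<Sum>j<v. b j) + min (\<Sum>i<u. a i) (\<Sum>j<v. b j))"

lemma overlap_nonneg:
  assumes "0 \<le> a u" "0 \<le> b v"
  shows "0 \<le> overlap a b (u, v)"
  using assms unfolding overlap_def by (auto simp: min_def)

lemma overlap_pos:
  assumes "0 \<le> a u" "0 \<le> b v" "0 < overlap a b (u, v)"
  shows "(\<Sum>i<u. a i) < (\<Sum>j<Suc v. b j)" "(\<Sum>j<v. b j) < (\<Sum>i<Suc u. a i)" "0 < a u" "0 < b v"
  using assms unfolding overlap_def by (auto simp: min_def split: if_splits)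

lemma overlap_commute: "overlap a b (u, v) = overlap b a (v, u)"
  unfolding overlap_def by (simp add: min.commute)

text \<open>
  The sum over \<open>v\<close> telescopes, and the pieces of the second kind exhaust the \<open>u\<close>-th piece of the first
  kind.  So the first marginal of the coupling is \<open>a\<close>.
\<close>

lemma sum_overlap:
  assumes "\<And>i. 0 \<le> a i" "(\<Sum>i<n. a i) \<le> (\<Sum>j<m. b j)" "u < n"
  shows "(\<Sum>v<m. overlap a b (u, v)) = a u"
proof -
  define F where "F v = min (\<Sum>i<Suc u. a i) (\<Sum>j<v. b j) - min (\<Sum>i<u. a i) (\<Sum>j<v. b j)" for v
  have "overlap a b (u, v) = F (Suc v) - F v" for v
    unfolding overlap_def F_def by simp
  then have "(\<Sum>v<m. overlap a b (u, v)) = F m - F 0"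
    by (simp add: sum_lessThan_telescope)
  moreover have "(\<Sum>i<Suc u. a i) \<le> (\<Sum>i<n. a i)"
    using assms by (intro sum_mono2) auto
  moreover have "0 \<le> (\<Sum>i<u. a i)" using assms by (intro sum_nonneg) auto
  ultimately show ?thesis using assms(1)[of u] assms(2) unfolding F_def by simp
qed

text \<open>
  The support of the coupling is a chain in the product order.  This is what keeps the dimension
  of a product of simplices additive.
\<close>

lemma overlap_chain:
  assumes "\<And>i. 0 \<le> a i" "\<And>j. 0 \<le> b j"
    and "0 < overlap a b (u, v)" "0 < overlap a b (u', v')" "u < u'"
  shows "v \<le> v'"
proof (rule ccontr)
  assume "\<not> v \<le> v'"
  then have "(\<Sum>j<Suc v'. b j) \<le> (\<Sum>j<v. b j)"
    using assms by (intro sum_mono2) auto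
  also have "\<dots> < (\<Sum>i<Suc u. a i)" using overlap_pos[OF _ _ assms(3)] assms(1,2) by blast
  also have "\<dots> \<le> (\<Sum>i<u'. a i)" using assms by (intro sum_mono2) auto
  also have "\<dots> < (\<Sum>j<Suc v'. b j)" using overlap_pos[OF _ _ assms(4)] assms(1,2) by blast
  finally show False .
qed

text \<open>
  Barycentric coordinates \<open>a\<close> and \<open>b\<close> of points of two polyhedra are combined into their monotone
  coupling.  The marginals recover \<open>a\<close> and \<open>b\<close>, so no points are identified beyond those that both
  maps identify.  A set of vertices between two supports is a chain whose projections are simplices
  of \<open>K\<close> and \<open>L\<close>, so its dimension is at most the sum of their dimensions.
\<close>

lemma Widim_product:
  assumes S: "continuous_map X X S" and eps: "0 < \<epsilon>"
    and K: "finite_complex K" and f: "eps_embedding X d1 \<epsilon> (polyhedron_top K) f"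
    and L: "finite_complex L" and g: "eps_embedding X d2 \<epsilon> (polyhedron_top L) g"
    and bd1: "\<And>x y. x \<in> topspace X \<Longrightarrow> y \<in> topspace X \<Longrightarrow> d1 x y \<le> B1"
    and bd2: "\<And>x y. x \<in> topspace X \<Longrightarrow> y \<in> topspace X \<Longrightarrow> d2 x y \<le> B2"
    and d: "\<And>x y. x \<in> topspace X \<Longrightarrow> y \<in> topspace X \<Longrightarrow> d x y \<le> max (d1 x y) (d2 (S x) (S y))"
    and p: "\<And>x. x \<in> topspace X \<Longrightarrow> real (local_dim K (f x)) + \<phi>1 x \<le> p"
    and q: "\<And>x. x \<in> topspace X \<Longrightarrow> real (local_dim L (g x)) + \<phi>2 x \<le> q"
    and \<phi>: "\<And>x. x \<in> topspace X \<Longrightarrow> \<phi> x \<le> \<phi>1 x + \<phi>2 (S x)"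
  shows "Widim X d \<phi> \<epsilon> \<le> ereal (p + q)"
proof -
  have "finite (\<Union>K \<union> \<Union>L)" using K L unfolding finite_complex_def by auto
  then obtain n where "\<Union>K \<union> \<Union>L \<subseteq> {..<n}"
    by (meson finite_nat_iff_bounded)
  then have n: "\<Union>K \<subseteq> {..<n}" "\<Union>L \<subseteq> {..<n}" by auto
  have SX: "S x \<in> topspace X" if "x \<in> topspace X" for x
    using S that by (simp add: continuous_map_def Pi_iff)
  have fK: "f x \<in> polyhedron_of K" and gL: "g x \<in> polyhedron_of L" if "x \<in> topspace X" for x
    using f g that
    by (auto simp: eps_embedding_def polyhedron_top_def continuous_map_in_subtopology)
  note fp = polyhedron_of_points[OF fK K n(1)] and gp = polyhedron_of_points[OF gL L n(2)]
  have f_cont: "continuous_map X euclideanreal (\<lambda>x. f x k)"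
    and g_cont: "continuous_map X euclideanreal (\<lambda>x. g x k)" for k
    using f g
    by (auto simp: eps_embedding_def polyhedron_top_def continuous_map_in_subtopology
        continuous_map_componentwise_UNIV)
  have gS_cont: "continuous_map X euclideanreal (\<lambda>x. g (S x) k)" for k
    using continuous_map_compose[OF S g_cont[of k]] by (simp add: o_def)
  define w where "w x = overlap (f x) (g (S x))" for x
  have marg1: "(\<Sum>v<n. w x (u, v)) = f x u" if "x \<in> topspace X" "u < n" for x u
    unfolding w_def by (rule sum_overlap[of _ n]) (use that fp gp SX in auto)
  have marg2: "(\<Sum>u<n. w x (u, v)) = g (S x) v" if "x \<in> topspace X" "v < n" for x v
    unfolding w_def overlap_commute[of "f x"]
    by (rule sum_overlap[of _ n]) (use that fp gp SX in auto)
  have w_nonneg: "0 \<le> w x v" if "x \<in> topspace X" for x v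
    unfolding w_def using overlap_nonneg that fp(1) gp(1) SX by (cases v) auto
  show ?thesis
  proof (rule Widim_le_of_weights[where V = "{..<n} \<times> {..<n}" and w = w])
    fix v
    show "continuous_map X euclideanreal (\<lambda>x. w x v)"
      unfolding w_def overlap_def split_def
      by (intro continuous_intros f_cont gS_cont finite_lessThan)
  next
    fix x assume x: "x \<in> topspace X"
    have "(\<Sum>v\<in>{..<n} \<times> {..<n}. w x v) = (\<Sum>u<n. \<Sum>v<n. w x (u, v))"
      by (simp add: sum.cartesian_product)
    also have "\<dots> = 1" using marg1[OF x] fp(3)[OF x] by simp
    finally show "(\<Sum>v\<in>{..<n} \<times> {..<n}. w x v) = 1" .
  next
    fix x assume x: "x \<in> topspace X"
    let ?F = "{y \<in> topspace X. \<forall>v\<in>{..<n} \<times> {..<n}. w y v = w x v}"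
    let ?G = "{y \<in> topspace X. f y = f x}" and ?H = "{y \<in> topspace X. g y = g (S x)}"
    have FG: "y \<in> ?G \<and> S y \<in> ?H" if y: "y \<in> ?F" for y
    proof -
      have yX: "y \<in> topspace X" and eq: "\<And>u v. u < n \<Longrightarrow> v < n \<Longrightarrow> w y (u, v) = w x (u, v)"
        using y by auto
      have "f y u = f x u" for u
      proof (cases "u < n")
        case True
        then show ?thesis using marg1[OF x, of u] marg1[OF yX, of u] eq by simp
      next
        case False
        then show ?thesis using fp(2)[OF x] fp(2)[OF yX] by simp
      qed
      moreover have "g (S y) v = g (S x) v" for v
      proof (cases "v < n")
        case True
        then show ?thesis using marg2[OF x, of v] marg2[OF yX, of v] eq by simp
      next
        case False
        then show ?thesis using gp(2)[OF SX[OF x]] gp(2)[OF SX[OF yX]] by simp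
      qed
      ultimately show ?thesis using yX SX by auto
    qed
    have dG: "diam d1 ?G < \<epsilon>" and dH: "diam d2 ?H < \<epsilon>"
      using f g fK[OF x] gL[OF SX[OF x]]
      by (auto simp: eps_embedding_def polyhedron_top_def)
    have "diam d ?F \<le> max (diam d1 ?G) (diam d2 ?H)"
    proof (rule diam_le)
      fix y z assume yz: "y \<in> ?F" "z \<in> ?F"
      have "d1 y z \<le> diam d1 ?G"
        using FG yz bd1 by (intro le_diam[of _ _ B1]) auto
      moreover have "d2 (S y) (S z) \<le> diam d2 ?H"
        using FG[OF yz(1)] FG[OF yz(2)] bd2 by (intro le_diam[of _ _ B2]) auto
      ultimately show "d y z \<le> max (diam d1 ?G) (diam d2 ?H)"
        using d[of y z] yz by auto
    qed (use x in auto)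
    then show "diam d ?F < \<epsilon>" using dG dH by linarith
  next
    fix x y s
    assume x: "x \<in> topspace X" and y: "y \<in> topspace X" and ne: "s \<noteq> {}"
      and xs: "{v \<in> {..<n} \<times> {..<n}. 0 < w x v} \<subseteq> s"
      and sy: "s \<subseteq> {v \<in> {..<n} \<times> {..<n}. 0 < w y v}"
    note Sx = SX[OF x] and Sy = SX[OF y]
    have fin: "finite s" using sy by (rule finite_subset) auto
    have chain: "snd r \<le> snd t" if "r \<in> s" "t \<in> s" "fst r < fst t" for r t
      using that sy overlap_chain[of "f y" "g (S y)" "fst r" "snd r" "fst t" "snd t"]
        fp(1)[OF y] gp(1)[OF Sy] unfolding w_def by auto
    obtain k where k: "k \<in> K" "{u. 0 < f y u} \<subseteq> k" using fp(4)[OF y] by blast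
    obtain l where l: "l \<in> L" "{u. 0 < g (S y) u} \<subseteq> l" using gp(4)[OF Sy] by blast
    have pos: "0 < f y u \<and> 0 < g (S y) v" if "(u, v) \<in> s" for u v
      using that sy overlap_pos[of "f y" u "g (S y)" v] fp(1)[OF y] gp(1)[OF Sy]
      unfolding w_def by auto
    have "fst ` s \<subseteq> k" "snd ` s \<subseteq> l" using pos k l by fastforce+
    then have mem: "fst ` s \<in> K" "snd ` s \<in> L"
      using k(1) l(1) K L ne unfolding finite_complex_def by (metis image_is_empty)+
    have "{u. 0 < f x u} \<subseteq> fst ` s"
    proof
      fix u assume u: "u \<in> {u. 0 < f x u}"
      then have un: "u < n" using fp(2)[OF x, of u] by (cases "u < n") auto
      then have "0 < (\<Sum>v<n. w x (u, v))" using marg1[OF x] u by simp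
      then obtain v where "v < n" "0 < w x (u, v)"
        by (meson lessThan_iff not_le sum_nonpos)
      then have "(u, v) \<in> s" using xs un by auto
      then show "u \<in> fst ` s" by force
    qed
    then have 1: "card (fst ` s) - 1 \<le> local_dim K (f x)"
      by (intro local_dim_ge K fK x mem)
    have "{v. 0 < g (S x) v} \<subseteq> snd ` s"
    proof
      fix v assume v: "v \<in> {v. 0 < g (S x) v}"
      then have vn: "v < n" using gp(2)[OF Sx, of v] by (cases "v < n") auto
      then have "0 < (\<Sum>u<n. w x (u, v))" using marg2[OF x] v by simp
      then obtain u where "u < n" "0 < w x (u, v)"
        by (meson lessThan_iff not_le sum_nonpos)
      then have "(u, v) \<in> s" using xs vn by auto
      then show "v \<in> snd ` s" by force
    qed
    then have 2: "card (snd ` s) - 1 \<le> local_dim L (g (S x))"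
      by (intro local_dim_ge L gL Sx mem)
    have "card s - 1 \<le> local_dim K (f x) + local_dim L (g (S x))"
      using card_chain_prod[OF fin ne chain] 1 2 fin ne
      by (simp add: card_gt_0_iff)
    then show "real (card s - 1) + \<phi> x \<le> p + q"
      using p[OF x] q[OF Sx] \<phi>[OF x] by linarith
  qed (use eps w_nonneg in auto)
qed

section \<open>Maps to a cube that avoid a generic point\<close>

lemma continuous_map_attains_inf:
  fixes h :: "'a \<Rightarrow> real"
  assumes "compact_space X" "closedin X C" "C \<noteq> {}" "continuous_map X euclideanreal h"
  shows "\<exists>x\<in>C. \<forall>y\<in>C. h x \<le> h y"
proof -
  have "compact (h ` C)"
    using image_compactin[OF closedin_compact_space[OF assms(1,2)] assms(4)] by simp
  then show ?thesis using compact_attains_inf[of "h ` C"] assms(3) by auto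
qed

text \<open>
  On the compact set where \<open>\<phi>\<close> is at least \<open>c\<close>, the sum of the distances \<open>\<bar>F i x - t i\<bar>\<close> is positive
  and attains its minimum.
\<close>

lemma uniform_avoidance:
  fixes F :: "'i \<Rightarrow> 'a \<Rightarrow> real"
  assumes X: "compact_space X" and A: "finite A"
    and F: "\<And>i. i \<in> A \<Longrightarrow> continuous_map X euclideanreal (F i)"
    and \<phi>: "continuous_map X euclideanreal \<phi>"
    and avoid: "\<And>x. x \<in> topspace X \<Longrightarrow> c \<le> \<phi> x \<Longrightarrow> \<exists>i\<in>A. F i x \<noteq> t i"
  shows "\<exists>r>0. \<forall>x\<in>topspace X. c \<le> \<phi> x \<longrightarrow> (\<exists>i\<in>A. r \<le> \<bar>F i x - t i\<bar>)"
proof -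
  define C where "C = {x \<in> topspace X. \<phi> x \<in> {c..}}"
  define h where "h x = (\<Sum>i\<in>A. \<bar>F i x - t i\<bar>)" for x
  have C: "closedin X C"
    unfolding C_def using \<phi> by (rule closedin_continuous_map_preimage) simp
  have h_cont: "continuous_map X euclideanreal h"
    unfolding h_def using F A by (intro continuous_intros) auto
  show ?thesis
  proof (cases "C = {}")
    case True
    then show ?thesis by (intro exI[of _ 1]) (auto simp: C_def)
  next
    case False
    then obtain z where z: "z \<in> C" "\<And>x. x \<in> C \<Longrightarrow> h z \<le> h x"
      using continuous_map_attains_inf[OF X C False h_cont] by blast
    obtain i where i: "i \<in> A" "F i z \<noteq> t i" using avoid z(1) by (auto simp: C_def)
    have "0 < h z"
      unfolding h_def using i A by (intro sum_pos2[of _ i]) auto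
    define r where "r = h z / (real (card A) + 1)"
    have r: "0 < r" using \<open>0 < h z\<close> by (simp add: r_def)
    have "\<exists>i\<in>A. r \<le> \<bar>F i x - t i\<bar>" if x: "x \<in> topspace X" "c \<le> \<phi> x" for x
    proof (rule ccontr)
      assume "\<not> ?thesis"
      then have "h x \<le> (\<Sum>i\<in>A. r)"
        unfolding h_def by (intro sum_mono) (auto simp: not_le intro: less_imp_le)
      also have "\<dots> < (real (card A) + 1) * r" using r by (simp add: algebra_simps)
      also have "\<dots> = h z" by (simp add: r_def)
      finally show False using z(2)[of x] x by (simp add: C_def)
    qed
    with r show ?thesis by blast
  qed
qed

text \<open>
  Unnormalised barycentric coordinates for the triangulation of the cube with coordinates \<open>I\<close> in
  which the vertices of a simplex form a chain of subsets of \<open>I\<close>.  The weight of \<open>S\<close> at the point \<open>g\<close> is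
  positive exactly if \<open>S\<close> is a set of the form \<open>{i. g i > \<lambda>}\<close> for some \<open>\<lambda>\<close> with \<open>0 \<le> \<lambda> < 1\<close>.
\<close>

definition level_weight :: "'i set \<Rightarrow> ('i \<Rightarrow> real) \<Rightarrow> 'i set \<Rightarrow> real" where
  "level_weight I g S =
     (\<Prod>i\<in>S. g i) * (\<Prod>j\<in>I - S. 1 - g j) * (\<Prod>i\<in>S. \<Prod>j\<in>I - S. max 0 (g i - g j))"

lemma level_weight_nonneg:
  assumes "\<And>i. i \<in> I \<Longrightarrow> 0 \<le> g i \<and> g i \<le> 1" "S \<subseteq> I"
  shows "0 \<le> level_weight I g S"
  unfolding level_weight_def using assms by (intro mult_nonneg_nonneg prod_nonneg) auto

lemma level_weight_pos_iff:
  assumes "finite I" "\<And>i. i \<in> I \<Longrightarrow> 0 \<le> g i \<and> g i \<le> 1" "S \<subseteq> I"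
  shows "0 < level_weight I g S \<longleftrightarrow>
    (\<forall>i\<in>S. 0 < g i) \<and> (\<forall>j\<in>I - S. g j < 1) \<and> (\<forall>i\<in>S. \<forall>j\<in>I - S. g j < g i)"
proof -
  have fin: "finite S" "finite (I - S)" using assms by (auto intro: finite_subset)
  have "0 < level_weight I g S \<longleftrightarrow> level_weight I g S \<noteq> 0"
    using level_weight_nonneg[OF assms(2,3), of "\<lambda>i. i"] by auto
  also have "\<dots> \<longleftrightarrow> (\<forall>i\<in>S. g i \<noteq> 0) \<and> (\<forall>j\<in>I - S. 1 - g j \<noteq> 0)
      \<and> (\<forall>i\<in>S. \<forall>j\<in>I - S. max 0 (g i - g j) \<noteq> 0)"
    unfolding level_weight_def using fin by (auto simp: prod_zero_iff)
  also have "\<dots> \<longleftrightarrow> (\<forall>i\<in>S. 0 < g i) \<and> (\<forall>j\<in>I - S. g j < 1) \<and> (\<forall>i\<in>S. \<forall>j\<in>I - S. g j < g i)"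
  proof -
    have a: "g i \<noteq> 0 \<longleftrightarrow> 0 < g i" if "i \<in> S" for i
      using assms(2)[of i] assms(3) that by auto
    have b: "1 - g j \<noteq> 0 \<longleftrightarrow> g j < 1" if "j \<in> I - S" for j
      using assms(2)[of j] that by auto
    have c: "max 0 (g i - g j) \<noteq> 0 \<longleftrightarrow> g j < g i" for i j by (auto simp: max_def)
    show ?thesis by (intro conj_cong ball_cong refl a b c)
  qed
  finally show ?thesis .
qed

text \<open>
  The level sets of \<open>g\<close> form a chain between \<open>{i. g i = 1}\<close> and \<open>{i. g i > 0}\<close>, so there is at most one
  more of them than there are coordinates strictly between 0 and 1.
\<close>

lemma card_level_sets:
  assumes I: "finite I" and g: "\<And>i. i \<in> I \<Longrightarrow> 0 \<le> g i \<and> g i \<le> 1"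
    and s: "s \<subseteq> {S \<in> Pow I. 0 < level_weight I g S}"
  shows "card s - 1 \<le> card {i \<in> I. 0 < g i \<and> g i < 1}"
proof -
  define P Q where "P = {i \<in> I. g i = 1}" and "Q = {i \<in> I. 0 < g i}"
  have fin: "finite P" "finite Q" using I by (auto simp: P_def Q_def)
  have sI: "S \<subseteq> I" if "S \<in> s" for S using that s by auto
  have lev: "(\<forall>i\<in>S. 0 < g i) \<and> (\<forall>j\<in>I - S. g j < 1) \<and> (\<forall>i\<in>S. \<forall>j\<in>I - S. g j < g i)"
    if "S \<in> s" for S
    using that s level_weight_pos_iff[OF I g sI[OF that]] by auto
  have between: "P \<subseteq> S \<and> S \<subseteq> Q" if "S \<in> s" for S
    using lev[OF that] sI[OF that] unfolding P_def Q_def by force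
  have chain: "S \<subseteq> S' \<or> S' \<subseteq> S" if "S \<in> s" "S' \<in> s" for S S'
  proof (rule ccontr)
    assume "\<not> ?thesis"
    then obtain i j where "i \<in> S" "i \<notin> S'" "j \<in> S'" "j \<notin> S" by blast
    then show False using lev[OF that(1)] lev[OF that(2)] sI[OF that(1)] sI[OF that(2)]
      by (metis Diff_iff less_asym subsetD)
  qed
  have "inj_on card s"
  proof (rule inj_onI)
    fix S S' assume "S \<in> s" "S' \<in> s" "card S = card S'"
    then show "S = S'" using chain[of S S'] sI I
      by (metis card_subset_eq finite_subset)
  qed
  moreover have "card ` s \<subseteq> {card P..card Q}"
  proof safe
    fix S assume "S \<in> s"
    then show "card S \<in> {card P..card Q}"
      using between[of S] fin finite_subset[of S Q] by (simp add: card_mono)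
  qed
  ultimately have "card s \<le> card {card P..card Q}"
    by (metis card_image card_mono finite_atLeastAtMost)
  also have "\<dots> \<le> card (Q - P) + 1"
  proof -
    have "P \<subseteq> Q" by (auto simp: P_def Q_def)
    then have "card (Q - P) = card Q - card P" using fin by (simp add: card_Diff_subset)
    then show ?thesis by simp
  qed
  also have "Q - P = {i \<in> I. 0 < g i \<and> g i < 1}"
    using g unfolding P_def Q_def by force
  finally show ?thesis by simp
qed

text \<open>
  Stretching each \<open>F i\<close> around \<open>t i\<close> and truncating it to the unit interval, so that it is 0 or 1 unless \<open>F i x\<close>
  is very close to \<open>t i\<close>, gives a map to a cube.  By compactness, the image of \<open>x\<close> lies on a face whose dimension
  obeys the same bound as \<open>card {i \<in> I. F i x = t i}\<close>.  A vertex that has positive weight at both \<open>x\<close> and \<open>y\<close> excludes a coordinate with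
  \<open>F i x = 1\<close> and \<open>F i y = 0\<close>.  Hence points with a common vertex satisfy the two estimates in the
  hypothesis \<open>near\<close>: one makes the map an \<epsilon>-embedding, the other transfers the dimension bound from
  a point \<open>y\<close>, whose support spans a simplex around the image of \<open>x\<close>, to \<open>x\<close> itself.
\<close>

lemma Widim_le_of_separating_functions:
  fixes F :: "'i \<Rightarrow> 'a \<Rightarrow> real"
  assumes X: "compact_space X" and I: "finite I" and eps: "0 < \<epsilon>"
    and F: "\<And>i. i \<in> I \<Longrightarrow> continuous_map X euclideanreal (F i)"
    and \<phi>: "continuous_map X euclideanreal \<phi>"
    and t: "\<And>i. i \<in> I \<Longrightarrow> 0 < t i \<and> t i < 1"
    and near: "\<And>x y. x \<in> topspace X \<Longrightarrow> y \<in> topspace X \<Longrightarrow>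
        \<forall>i\<in>I. \<not> (F i x = 1 \<and> F i y = 0) \<Longrightarrow> \<phi> x \<le> \<phi> y + v \<and> d x y \<le> \<epsilon> / 2"
    and count: "\<And>x. x \<in> topspace X \<Longrightarrow> real (card {i \<in> I. F i x = t i}) + \<phi> x < c"
  shows "Widim X d \<phi> \<epsilon> \<le> ereal (c + v)"
proof -
  have "\<exists>r>0. \<forall>x\<in>topspace X. c - real (card A) \<le> \<phi> x \<longrightarrow> (\<exists>i\<in>A. r \<le> \<bar>F i x - t i\<bar>)"
    if A: "A \<subseteq> I" for A
  proof (rule uniform_avoidance[OF X _ _ \<phi>])
    show "finite A" using A I by (rule finite_subset)
    fix x assume x: "x \<in> topspace X" "c - real (card A) \<le> \<phi> x"
    show "\<exists>i\<in>A. F i x \<noteq> t i"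
    proof (rule ccontr)
      assume "\<not> ?thesis"
      then have "A \<subseteq> {i \<in> I. F i x = t i}" using A by auto
      then have "card A \<le> card {i \<in> I. F i x = t i}" using I by (intro card_mono) auto
      then show False using count[OF x(1)] x(2) by linarith
    qed
  qed (use F A in auto)
  \<comment> \<open>For a set \<open>A\<close> of coordinates too large for \<open>x\<close>, one coordinate in \<open>A\<close> stays away from \<open>t\<close>.  The
    least of the finitely many radii \<open>\<rho> A\<close> bounds the coordinates that become free after stretching.\<close>
  then obtain \<rho> where \<rho>: "\<And>A. A \<subseteq> I \<Longrightarrow> 0 < \<rho> A"
    "\<And>A x. A \<subseteq> I \<Longrightarrow> x \<in> topspace X \<Longrightarrow> c - real (card A) \<le> \<phi> x \<Longrightarrow>
       \<exists>i\<in>A. \<rho> A \<le> \<bar>F i x - t i\<bar>" by metis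
  define R where "R = insert 1 (\<rho> ` Pow I \<union> t ` I \<union> (\<lambda>i. 1 - t i) ` I)"
  define r where "r = Min R"
  have finR: "finite R" "R \<noteq> {}" using I by (auto simp: R_def)
  have "0 < r" unfolding r_def using finR \<rho>(1) t by (auto simp: Min_gr_iff R_def)
  have r_le: "r \<le> y" if "y \<in> R" for y using finR(1) that by (simp add: r_def)
  have r\<rho>: "r \<le> \<rho> A" if "A \<subseteq> I" for A using that by (intro r_le) (auto simp: R_def)
  have rt: "r \<le> t i" "r \<le> 1 - t i" if "i \<in> I" for i using that by (auto intro!: r_le simp: R_def)
  define g where "g x i = max 0 (min 1 ((F i x - t i) / (2 * r) + 1 / 2))" for x i
  have g01: "0 \<le> g x i \<and> g x i \<le> 1" for x i by (simp add: g_def)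
  have g0: "g x i = 0" if "i \<in> I" "F i x = 0" for x i
    using rt[OF that(1)] that(2) \<open>0 < r\<close> by (simp add: g_def max_def min_def field_simps)
  have g1: "g x i = 1" if "i \<in> I" "F i x = 1" for x i
    using rt[OF that(1)] that(2) \<open>0 < r\<close> by (simp add: g_def max_def min_def field_simps)
  have free: "\<bar>F i x - t i\<bar> < r" if "0 < g x i" "g x i < 1" for x i
    using that \<open>0 < r\<close> by (auto simp: g_def max_def min_def field_simps abs_less_iff split: if_splits)
  define W where "W x = level_weight I (g x)" for x
  define Z where "Z x = (\<Sum>S\<in>Pow I. W x S)" for x
  have W_nonneg: "0 \<le> W x S" if "S \<in> Pow I" for x S
    unfolding W_def using that g01 by (intro level_weight_nonneg) auto
  have W_pos: "0 < W x S \<longleftrightarrow>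
    (\<forall>i\<in>S. 0 < g x i) \<and> (\<forall>j\<in>I - S. g x j < 1) \<and> (\<forall>i\<in>S. \<forall>j\<in>I - S. g x j < g x i)"
    if "S \<in> Pow I" for x S
    unfolding W_def using that g01 I by (intro level_weight_pos_iff) auto
  \<comment> \<open>The set of coordinates equal to 1 always has positive weight.\<close>
  have Z_pos: "0 < Z x" for x
    unfolding Z_def
  proof (rule sum_pos2[of _ "{i \<in> I. g x i = 1}"])
    have "g x j < 1" if "j \<in> I - {i \<in> I. g x i = 1}" for j
      using that g01[of x j] by (auto simp: less_le)
    then show "0 < W x {i \<in> I. g x i = 1}" by (subst W_pos) auto
  qed (use I W_nonneg in auto)
  have g_cont: "continuous_map X euclideanreal (\<lambda>x. g x i)" if "i \<in> I" for i
    unfolding g_def using F[OF that] \<open>0 < r\<close> by (intro continuous_intros) auto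
  have W_cont: "continuous_map X euclideanreal (\<lambda>x. W x S)" if "S \<in> Pow I" for S
    unfolding W_def level_weight_def using that I g_cont
    by (intro continuous_intros) (auto intro: finite_subset)
  have pos_iff: "0 < W x S / Z x \<longleftrightarrow> 0 < W x S" for x S
    using Z_pos[of x] by (simp add: zero_less_divide_iff)
  have nearby: "\<phi> x \<le> \<phi> y + v \<and> d x y \<le> \<epsilon> / 2"
    if "x \<in> topspace X" "y \<in> topspace X" "S \<in> Pow I" "0 < W x S" "0 < W y S" for x y S
  proof (rule near[OF that(1,2)], intro ballI notI)
    fix i assume i: "i \<in> I" "F i x = 1 \<and> F i y = 0"
    then have "g x i = 1" "g y i = 0" using g0 g1 by auto
    then show False using that(3-5) i(1) W_pos[OF that(3)] by (metis DiffI less_irrefl)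
  qed
  show ?thesis
  proof (rule Widim_le_of_weights[where V = "Pow I" and w = "\<lambda>x S. W x S / Z x"])
    fix S assume S: "S \<in> Pow I"
    have "continuous_map X euclideanreal Z"
      unfolding Z_def using I W_cont by (intro continuous_intros) auto
    then show "continuous_map X euclideanreal (\<lambda>x. W x S / Z x)"
      using W_cont[OF S] Z_pos by (intro continuous_map_real_divide) (auto simp: less_imp_neq[symmetric])
  next
    fix x assume x: "x \<in> topspace X"
    show "(\<Sum>S\<in>Pow I. W x S / Z x) = 1"
      using Z_pos[of x] unfolding sum_divide_distrib[symmetric] by (simp add: Z_def)
  next
    fix x assume x: "x \<in> topspace X"
    let ?E = "{y \<in> topspace X. \<forall>S\<in>Pow I. W y S / Z y = W x S / Z x}"
    obtain S where S: "S \<in> Pow I" "0 < W x S"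
      using Z_pos[of x] unfolding Z_def by (meson not_le sum_nonpos)
    have "diam d ?E \<le> \<epsilon> / 2"
    proof (rule diam_le)
      fix y z assume yz: "y \<in> ?E" "z \<in> ?E"
      then have "0 < W y S" "0 < W z S" using S pos_iff by (metis (mono_tags, lifting) mem_Collect_eq)+
      then show "d y z \<le> \<epsilon> / 2" using nearby[of y z S] yz S by auto
    qed (use eps in auto)
    then show "diam d ?E < \<epsilon>" using eps by linarith
  next
    fix x y s assume x: "x \<in> topspace X" and y: "y \<in> topspace X" and ne: "s \<noteq> {}"
      and xs: "{S \<in> Pow I. 0 < W x S / Z x} \<subseteq> s" and sy: "s \<subseteq> {S \<in> Pow I. 0 < W y S / Z y}"
    obtain S where S: "S \<in> Pow I" "0 < W x S"
      using Z_pos[of x] unfolding Z_def by (meson not_le sum_nonpos)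
    then have "S \<in> s" using xs by (auto simp: pos_iff)
    then have "0 < W y S" using sy by (auto simp: pos_iff)
    then have \<phi>xy: "\<phi> x \<le> \<phi> y + v" using nearby[OF x y] S by blast
    define A where "A = {i \<in> I. \<bar>F i y - t i\<bar> < r}"
    have "card s - 1 \<le> card {i \<in> I. 0 < g y i \<and> g y i < 1}"
      using sy pos_iff g01 I by (intro card_level_sets) (auto simp: W_def)
    also have "\<dots> \<le> card A" unfolding A_def using I free by (intro card_mono) auto
    finally have "card s - 1 \<le> card A" .
    moreover have "real (card A) + \<phi> y < c"
    proof (rule ccontr)
      assume "\<not> ?thesis"
      then have "c - real (card A) \<le> \<phi> y" by linarith
      moreover have "A \<subseteq> I" by (auto simp: A_def)
      ultimately obtain i where "i \<in> A" "\<rho> A \<le> \<bar>F i y - t i\<bar>" using \<rho>(2) y by blast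
      then show False using r\<rho>[OF \<open>A \<subseteq> I\<close>] by (auto simp: A_def)
    qed
    ultimately show "real (card s - 1) + \<phi> x \<le> c + v" using \<phi>xy by linarith
  qed (use I eps W_nonneg Z_pos in \<open>auto intro!: divide_nonneg_pos\<close>)
qed

text \<open>
  A union bound for Lebesgue measure on the cube.  For each \<open>k\<close> and each set \<open>A\<close> of \<open>m k\<close> coordinates, the
  points \<open>t\<close> whose coordinates in \<open>A\<close> all lie in the given intervals form a box of volume at most
  \<open>l k ^ m k\<close>, and there are at most \<open>2 ^ card I\<close> choices of \<open>A\<close>.  The open unit cube has volume 1.
\<close>

lemma point_avoiding_boxes:
  fixes lo hi :: "nat \<Rightarrow> 'i \<Rightarrow> real" and m :: "nat \<Rightarrow> nat"
  assumes I: "finite I"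
    and len: "\<And>k i. i \<in> I \<Longrightarrow> hi k i - lo k i \<le> l k" and l: "\<And>k. 0 \<le> l k"
    and b: "\<And>k. m k \<le> card I \<Longrightarrow> ennreal (2 ^ card I * l k ^ m k) \<le> b k"
    and less: "(\<Sum>k. b k) < 1"
  shows "\<exists>t. (\<forall>i\<in>I. 0 < t i \<and> t i < 1) \<and>
    (\<forall>k. card {i \<in> I. lo k i \<le> t i \<and> t i \<le> hi k i} < m k)"
proof (rule ccontr)
  assume neg: "\<not> ?thesis"
  interpret product_sigma_finite "\<lambda>_::'i. lborel :: real measure" by standard
  let ?M = "PiM I (\<lambda>_. lborel :: real measure)"
  define side where "side k A i = (if i \<in> A then {lo k i..hi k i} else {0<..<1})" for k A i
  define Bad where "Bad k = (\<Union>A\<in>{A. A \<subseteq> I \<and> card A = m k}. Pi\<^sub>E I (side k A))" for k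
  have finA: "finite {A. A \<subseteq> I \<and> card A = m k}" for k using I by auto
  have box_sets: "Pi\<^sub>E I (side k A) \<in> sets ?M" for k A
    using I by (intro sets_PiM_I_finite) (auto simp: side_def)
  have Bad_sets: "Bad k \<in> sets ?M" for k
    unfolding Bad_def using finA box_sets by (intro sets.finite_UN) auto
  have Bad_le: "emeasure ?M (Bad k) \<le> b k" for k
  proof (cases "m k \<le> card I")
    case True
    have box: "emeasure ?M (Pi\<^sub>E I (side k A)) \<le> ennreal (l k ^ m k)"
      if A: "A \<subseteq> I" "card A = m k" for A
    proof -
      have "emeasure ?M (Pi\<^sub>E I (side k A)) = (\<Prod>i\<in>I. emeasure lborel (side k A i))"
        using I by (intro emeasure_PiM) (auto simp: side_def)
      also have "\<dots> \<le> (\<Prod>i\<in>I. if i \<in> A then ennreal (l k) else 1)"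
        using len by (intro prod_mono_ennreal) (auto simp: side_def emeasure_lborel_Icc_eq ennreal_leI)
      also have "\<dots> = ennreal (l k) ^ m k"
        using I A by (simp add: prod.If_cases Int_absorb1)
      finally show ?thesis by (simp add: ennreal_power l)
    qed
    have "emeasure ?M (Bad k) \<le> (\<Sum>A\<in>{A. A \<subseteq> I \<and> card A = m k}. emeasure ?M (Pi\<^sub>E I (side k A)))"
      unfolding Bad_def using finA box_sets by (intro emeasure_subadditive_finite) auto
    also have "\<dots> \<le> (\<Sum>A\<in>{A. A \<subseteq> I \<and> card A = m k}. ennreal (l k ^ m k))"
      using box by (intro sum_mono) auto
    also have "\<dots> = of_nat (card {A. A \<subseteq> I \<and> card A = m k}) * ennreal (l k ^ m k)" by simp
    also have "\<dots> \<le> of_nat (card (Pow I)) * ennreal (l k ^ m k)"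
      using I by (intro mult_right_mono of_nat_mono card_mono) auto
    also have "\<dots> = ennreal (2 ^ card I * l k ^ m k)"
      using I l by (simp add: card_Pow ennreal_mult ennreal_power[symmetric])
    also have "\<dots> \<le> b k" by (rule b[OF True])
    finally show ?thesis .
  next
    case False
    have "card A \<noteq> m k" if "A \<subseteq> I" for A using False card_mono[OF I that] by linarith
    then have "{A. A \<subseteq> I \<and> card A = m k} = {}" by blast
    then have "Bad k = {}" unfolding Bad_def by blast
    then show ?thesis by simp
  qed
  have "Pi\<^sub>E I (\<lambda>_. {0<..<1}) \<subseteq> (\<Union>k. Bad k)"
  proof
    fix t :: "'i \<Rightarrow> real" assume t: "t \<in> Pi\<^sub>E I (\<lambda>_. {0<..<1})"
    then have "\<forall>i\<in>I. 0 < t i \<and> t i < 1" by (auto simp: PiE_iff)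
    then have "\<not> (\<forall>k. card {i \<in> I. lo k i \<le> t i \<and> t i \<le> hi k i} < m k)"
      using neg by blast
    then obtain k where "m k \<le> card {i \<in> I. lo k i \<le> t i \<and> t i \<le> hi k i}"
      unfolding not_all not_less by blast
    then obtain A where A: "A \<subseteq> {i \<in> I. lo k i \<le> t i \<and> t i \<le> hi k i}" "card A = m k"
      by (meson obtain_subset_with_card_n)
    have "t \<in> Pi\<^sub>E I (side k A)" using t A(1) by (auto simp: PiE_iff side_def)
    then show "t \<in> (\<Union>k. Bad k)" unfolding Bad_def using A by blast
  qed
  then have "emeasure ?M (Pi\<^sub>E I (\<lambda>_. {0<..<1})) \<le> emeasure ?M (\<Union>k. Bad k)"
    using Bad_sets by (intro emeasure_mono) auto
  also have "\<dots> \<le> (\<Sum>k. emeasure ?M (Bad k))"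
    using Bad_sets by (intro emeasure_subadditive_countably) auto
  also have "\<dots> \<le> (\<Sum>k. b k)" using Bad_le by (intro suminf_le) auto
  finally have "emeasure ?M (Pi\<^sub>E I (\<lambda>_. {0<..<1})) < 1" using less by (rule le_less_trans)
  moreover have "emeasure ?M (Pi\<^sub>E I (\<lambda>_. {0<..<1})) = (\<Prod>i\<in>I. emeasure lborel {0<..<1::real})"
    using I by (intro emeasure_PiM) auto
  ultimately show False by simp
qed

section \<open>Compact dynamical systems and covering numbers\<close>

definition cover_term :: "real \<Rightarrow> ('a \<Rightarrow> real) \<Rightarrow> 'a set \<Rightarrow> real" where
  "cover_term \<epsilon> \<phi> U = (if U = {} then 0 else (1 / \<epsilon>) powr (SUP x\<in>U. \<phi> x))"

locale compact_system =
  fixes X :: "'a topology" and T :: "'a \<Rightarrow> 'a" and d :: "'a \<Rightarrow> 'a \<Rightarrow> real"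
  assumes dyn: "dynamical_system X T" and met: "compatible_metric X d"
    and nonempty: "topspace X \<noteq> {}"
begin

abbreviation dN :: "nat \<Rightarrow> 'a \<Rightarrow> 'a \<Rightarrow> real" where
  "dN \<equiv> dyn_metric T d"

sublocale Metric_space "topspace X" d
  using met by (simp add: compatible_metric_def)

lemma mtopology_eq: "mtopology = X"
  using met by (simp add: compatible_metric_def)

lemma compact: "compact_space X"
  using dyn by (simp add: dynamical_system_def)

lemma iterate_cont: "continuous_map X X (T ^^ n)"
proof (induction n)
  case (Suc n)
  have "continuous_map X X T"
    using dyn by (simp add: dynamical_system_def homeomorphic_imp_continuous_map)
  from continuous_map_compose[OF Suc this] show ?case by (simp add: o_def)
qed (simp add: id_def)

lemma iterate_in: "x \<in> topspace X \<Longrightarrow> (T ^^ n) x \<in> topspace X"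
  using iterate_cont[of n] by (simp add: continuous_map_def Pi_iff)

lemma dist_cont: "p \<in> topspace X \<Longrightarrow> continuous_map X euclideanreal (d p)"
  using continuous_on_mdist[of p "metric (topspace X, d)"] Metric_space_axioms
  by (simp add: mtopology_of_def Metric_space.mspace_metric Metric_space.mdist_metric mtopology_eq)

lemma cont_bounded:
  assumes "continuous_map X euclideanreal g"
  obtains B where "\<And>x. x \<in> topspace X \<Longrightarrow> \<bar>g x\<bar> \<le> B"
proof -
  have "compactin X (topspace X)" using compact by (simp add: compact_space_def)
  from image_compactin[OF this assms] have "compact (g ` topspace X)" by simp
  then have "bounded (g ` topspace X)" by (rule compact_imp_bounded)
  then show ?thesis using that unfolding bounded_iff by auto
qed

lemma cont_bdd_above:
  assumes "continuous_map X euclideanreal g" "A \<subseteq> topspace X"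
  shows "bdd_above (g ` A)"
proof -
  obtain B where "\<And>x. x \<in> topspace X \<Longrightarrow> \<bar>g x\<bar> \<le> B" using cont_bounded[OF assms(1)] by blast
  then have "\<And>x. x \<in> A \<Longrightarrow> g x \<le> B" using assms(2) by fastforce
  then show ?thesis by (auto intro!: bdd_aboveI[of _ B])
qed

lemma le_SUP:
  assumes "continuous_map X euclideanreal g" "A \<subseteq> topspace X" "x \<in> A"
  shows "g x \<le> (SUP x\<in>A. g x)"
  using cSUP_upper[OF assms(3) cont_bdd_above[OF assms(1,2)]] .

lemma dist_bounded:
  obtains B where "\<And>x y. x \<in> topspace X \<Longrightarrow> y \<in> topspace X \<Longrightarrow> d x y \<le> B"
proof -
  obtain p where p: "p \<in> topspace X" using nonempty by blast
  obtain B where B: "\<And>x. x \<in> topspace X \<Longrightarrow> \<bar>d p x\<bar> \<le> B"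
    using cont_bounded[OF dist_cont[OF p]] by blast
  show ?thesis
  proof (rule that[of "B + B"])
    fix x y assume xy: "x \<in> topspace X" "y \<in> topspace X"
    have "d x y \<le> d p x + d p y" using triangle[of x p y] xy p by (simp add: commute)
    then show "d x y \<le> B + B" using B[OF xy(1)] B[OF xy(2)] by linarith
  qed
qed

lemma dN_ge:
  assumes "n < N"
  shows "d ((T ^^ n) x) ((T ^^ n) y) \<le> dN N x y"
  using dyn_metric_le_iff[of N T d x y "dN N x y"] assms by auto

lemma dN_nonneg: "1 \<le> N \<Longrightarrow> 0 \<le> dN N x y"
proof -
  assume "1 \<le> N"
  then have "d x y \<le> dN N x y" using dN_ge[of 0 N x y] by simp
  then show ?thesis using nonneg[of x y] by linarith
qed

lemma dN_bounded:
  assumes "1 \<le> N"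
  obtains B where "\<And>x y. x \<in> topspace X \<Longrightarrow> y \<in> topspace X \<Longrightarrow> dN N x y \<le> B"
proof -
  obtain B where "\<And>x y. x \<in> topspace X \<Longrightarrow> y \<in> topspace X \<Longrightarrow> d x y \<le> B"
    using dist_bounded by blast
  then show ?thesis using assms iterate_in by (intro that[of B]) (simp add: dyn_metric_le_iff)
qed

lemma dN_le_diam:
  assumes "1 \<le> N" "E \<subseteq> topspace X" "x \<in> E" "y \<in> E"
  shows "dN N x y \<le> diam (dN N) E"
proof -
  obtain B where "\<And>x y. x \<in> topspace X \<Longrightarrow> y \<in> topspace X \<Longrightarrow> dN N x y \<le> B"
    using dN_bounded[OF assms(1)] by blast
  then show ?thesis using assms by (intro le_diam[of _ _ B]) auto
qed

lemma diam_dN_nonneg: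
  assumes "1 \<le> N" "E \<subseteq> topspace X"
  shows "0 \<le> diam (dN N) E"
proof (cases "E = {}")
  case False
  then obtain x where "x \<in> E" by blast
  then show ?thesis using dN_le_diam[OF assms, of x x] dN_nonneg[OF assms(1), of x x] by linarith
qed (simp add: diam_def)

lemma dN_triangle:
  assumes "1 \<le> N" "x \<in> topspace X" "y \<in> topspace X" "z \<in> topspace X"
    and "dN N z x < r" "dN N z y < r"
  shows "dN N x y \<le> 2 * r"
proof -
  have "d ((T ^^ n) x) ((T ^^ n) y) \<le> 2 * r" if "n < N" for n
  proof -
    have "d ((T ^^ n) x) ((T ^^ n) y) \<le> d ((T ^^ n) z) ((T ^^ n) x) + d ((T ^^ n) z) ((T ^^ n) y)"
      using triangle[of "(T ^^ n) x" "(T ^^ n) z" "(T ^^ n) y"] iterate_in assms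
      by (simp add: commute)
    then show ?thesis using dN_ge[OF that, of z x] dN_ge[OF that, of z y] assms by linarith
  qed
  then show ?thesis using assms(1) by (simp add: dyn_metric_le_iff)
qed

lemma openin_dN_ball:
  assumes "1 \<le> N" "p \<in> topspace X"
  shows "openin X {x \<in> topspace X. dN N p x < r}"
proof -
  have "openin X {x \<in> topspace X. d ((T ^^ n) p) ((T ^^ n) x) \<in> {..<r}}" for n
  proof (rule openin_continuous_map_preimage)
    show "continuous_map X euclideanreal (\<lambda>x. d ((T ^^ n) p) ((T ^^ n) x))"
      using continuous_map_compose[OF iterate_cont[of n] dist_cont[OF iterate_in[OF assms(2), of n]]]
      by (simp add: o_def)
  qed simp
  then have "openin X ((\<Inter>n\<in>{..<N}. {x \<in> topspace X. d ((T ^^ n) p) ((T ^^ n) x) \<in> {..<r}}) \<inter> topspace X)"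
    by (intro openin_INT) auto
  also have "(\<Inter>n\<in>{..<N}. {x \<in> topspace X. d ((T ^^ n) p) ((T ^^ n) x) \<in> {..<r}}) \<inter> topspace X
      = {x \<in> topspace X. dN N p x < r}"
    using assms(1) by (auto simp: dyn_metric_less_iff)
  finally show ?thesis .
qed

lemma finite_net:
  assumes "1 \<le> N" "0 < r"
  obtains P where "finite P" "P \<subseteq> topspace X"
    "\<And>x. x \<in> topspace X \<Longrightarrow> \<exists>p\<in>P. dN N p x < r"
proof -
  let ?ball = "\<lambda>p. {x \<in> topspace X. dN N p x < r}"
  have self: "x \<in> ?ball x" if "x \<in> topspace X" for x
    using assms that iterate_in by (simp add: dyn_metric_less_iff mdist_zero)
  have "(\<forall>U\<in>?ball ` topspace X. openin X U) \<and> topspace X \<subseteq> \<Union>(?ball ` topspace X)"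
    using openin_dN_ball[OF assms(1)] self by blast
  then obtain \<F> where \<F>: "finite \<F>" "\<F> \<subseteq> ?ball ` topspace X" "topspace X \<subseteq> \<Union>\<F>"
    using compact[unfolded compact_space_alt, THEN spec, THEN mp] by meson
  obtain P where P: "P \<subseteq> topspace X" "finite P" "\<F> = ?ball ` P"
    using finite_subset_image[OF \<F>(1,2)] by blast
  show ?thesis
  proof (rule that[OF P(2,1)])
    fix x assume "x \<in> topspace X"
    then show "\<exists>p\<in>P. dN N p x < r" using \<F>(3) P(3) by blast
  qed
qed

lemma cover_number_le:
  assumes I: "finite I" and U: "\<And>i. i \<in> I \<Longrightarrow> openin X (U i) \<and> diam \<delta> (U i) < \<epsilon>"
    and cov: "(\<Union>i\<in>I. U i) = topspace X"
  shows "cover_number X \<delta> \<phi> \<epsilon> \<le> (\<Sum>i\<in>I. cover_term \<epsilon> \<phi> (U i))"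
proof -
  obtain h where h: "bij_betw h {..<card I} I"
    using ex_bij_betw_nat_finite[OF I] by (auto simp: atLeast0LessThan)
  let ?S = "{\<Sum>i<n. if U i = {} then 0 else (1 / \<epsilon>) powr (SUP x \<in> U i. \<phi> x) | (n :: nat) U.
            (\<forall>i<n. openin X (U i) \<and> diam \<delta> (U i) < \<epsilon>) \<and> (\<Union>i<n. U i) = topspace X}"
  have "bdd_below ?S" by (rule bdd_belowI[of _ 0]) (auto intro!: sum_nonneg)
  moreover have "(\<Sum>i\<in>I. cover_term \<epsilon> \<phi> (U i)) \<in> ?S"
  proof -
    have "(\<Sum>i\<in>I. cover_term \<epsilon> \<phi> (U i)) = (\<Sum>k<card I. cover_term \<epsilon> \<phi> (U (h k)))"
      using sum.reindex_bij_betw[OF h, of "\<lambda>i. cover_term \<epsilon> \<phi> (U i)"] by simp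
    moreover have "\<forall>k<card I. openin X (U (h k)) \<and> diam \<delta> (U (h k)) < \<epsilon>"
      using U h by (auto dest: bij_betwE)
    moreover have "(\<Union>k<card I. U (h k)) = topspace X"
      using cov bij_betw_imp_surj_on[OF h] by (metis image_image)
    ultimately show ?thesis
      unfolding cover_term_def
      by (intro CollectI exI[of _ "card I"] exI[of _ "\<lambda>k. U (h k)"] conjI)
  qed
  ultimately show ?thesis unfolding cover_number_def by (rule cInf_lower[rotated])
qed

text \<open>
  The infimum in \<open>cover_number\<close> is taken over a nonempty set of reals: balls around a finite net form
  a cover.
\<close>

lemma cover_number_ge:
  assumes N: "1 \<le> N" and eps: "0 < \<epsilon>"
    and le: "\<And>n (U :: nat \<Rightarrow> 'a set). (\<And>i. i < n \<Longrightarrow> openin X (U i)) \<Longrightarrow>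
      (\<And>i. i < n \<Longrightarrow> diam (dN N) (U i) < \<epsilon>) \<Longrightarrow> (\<Union>i<n. U i) = topspace X \<Longrightarrow>
      c \<le> (\<Sum>i<n. cover_term \<epsilon> \<phi> (U i))"
  shows "c \<le> cover_number X (dN N) \<phi> \<epsilon>"
  unfolding cover_number_def
proof (rule cInf_greatest)
  obtain P where P: "finite P" "P \<subseteq> topspace X"
    "\<And>x. x \<in> topspace X \<Longrightarrow> \<exists>p\<in>P. dN N p x < \<epsilon> / 3"
    using finite_net[OF N, of "\<epsilon> / 3"] eps by auto
  let ?ball = "\<lambda>p. {x \<in> topspace X. dN N p x < \<epsilon> / 3}"
  obtain h where h: "bij_betw h {..<card P} P"
    using ex_bij_betw_nat_finite[OF P(1)] by (auto simp: atLeast0LessThan)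
  have W1: "openin X (?ball (h k)) \<and> diam (dN N) (?ball (h k)) < \<epsilon>" if "k < card P" for k
  proof -
    have hk: "h k \<in> topspace X" using that h P(2) by (auto dest: bij_betwE)
    have "diam (dN N) (?ball (h k)) \<le> 2 * (\<epsilon> / 3)"
    proof (rule diam_le)
      fix x y assume "x \<in> ?ball (h k)" "y \<in> ?ball (h k)"
      then show "dN N x y \<le> 2 * (\<epsilon> / 3)" using dN_triangle[OF N _ _ hk, of x y "\<epsilon> / 3"] by blast
    qed (use eps in auto)
    then show ?thesis using eps by (intro conjI openin_dN_ball N hk) linarith
  qed
  have W2: "(\<Union>k<card P. ?ball (h k)) = topspace X"
  proof -
    have "(\<Union>k<card P. ?ball (h k)) = (\<Union>p\<in>h ` {..<card P}. ?ball p)" by blast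
    also have "\<dots> = topspace X" using P(3) bij_betw_imp_surj_on[OF h] by auto
    finally show ?thesis .
  qed
  have "(\<Sum>i<card P. if ?ball (h i) = {} then 0 else (1 / \<epsilon>) powr (SUP x \<in> ?ball (h i). \<phi> x)) \<in> {\<Sum>i<n. if U i = {} then 0 else (1 / \<epsilon>) powr (SUP x \<in> U i. \<phi> x) | (n :: nat) U.
            (\<forall>i<n. openin X (U i) \<and> diam (dN N) (U i) < \<epsilon>) \<and> (\<Union>i<n. U i) = topspace X}"
    by (intro CollectI exI[of _ "card P"] exI[of _ "\<lambda>k. ?ball (h k)"] conjI refl W2)
      (use W1 in blast)
  then show "{\<Sum>i<n. if U i = {} then 0 else (1 / \<epsilon>) powr (SUP x \<in> U i. \<phi> x) | (n :: nat) U.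
            (\<forall>i<n. openin X (U i) \<and> diam (dN N) (U i) < \<epsilon>) \<and> (\<Union>i<n. U i) = topspace X} \<noteq> {}"
    by (rule ex_in_conv[THEN iffD1, OF exI])
next
  fix z assume "z \<in> {\<Sum>i<n. if U i = {} then 0 else (1 / \<epsilon>) powr (SUP x \<in> U i. \<phi> x) | (n :: nat) U.
            (\<forall>i<n. openin X (U i) \<and> diam (dN N) (U i) < \<epsilon>) \<and> (\<Union>i<n. U i) = topspace X}"
  then show "c \<le> z" using le unfolding cover_term_def by blast
qed

lemma cover_sum_pos:
  assumes "(\<Union>i<n. U i) = topspace X" "0 < \<epsilon>"
    and \<phi>: "continuous_map X euclideanreal \<phi>" "\<epsilon> \<le> 1"
    and lb: "\<And>x. x \<in> topspace X \<Longrightarrow> b \<le> \<phi> x"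
  shows "(1 / \<epsilon>) powr b \<le> (\<Sum>i<(n::nat). cover_term \<epsilon> \<phi> (U i))"
proof -
  obtain x where x: "x \<in> topspace X" using nonempty by blast
  then obtain i where i: "i < n" "x \<in> U i" using assms(1) by blast
  have "U i \<subseteq> topspace X" using i assms(1) by blast
  then have "b \<le> (SUP x\<in>U i. \<phi> x)" using le_SUP[OF \<phi>(1) _ i(2)] lb[OF x] by fastforce
  then have "(1 / \<epsilon>) powr b \<le> cover_term \<epsilon> \<phi> (U i)"
    using i assms unfolding cover_term_def by (auto intro!: powr_mono)
  also have "\<dots> \<le> (\<Sum>i<n. cover_term \<epsilon> \<phi> (U i))"
    using i by (intro member_le_sum) (auto simp: cover_term_def)
  finally show ?thesis .
qed

lemma cover_number_pos:
  assumes N: "1 \<le> N" and eps: "0 < \<epsilon>" "\<epsilon> \<le> 1" and \<phi>: "continuous_map X euclideanreal \<phi>"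
  shows "0 < cover_number X (dN N) \<phi> \<epsilon>"
proof -
  obtain B where B: "\<And>x. x \<in> topspace X \<Longrightarrow> \<bar>\<phi> x\<bar> \<le> B" using cont_bounded[OF \<phi>] by blast
  then have "\<And>x. x \<in> topspace X \<Longrightarrow> - B \<le> \<phi> x" by fastforce
  then have "(1 / \<epsilon>) powr - B \<le> cover_number X (dN N) \<phi> \<epsilon>"
    using eps \<phi> by (intro cover_number_ge[OF N] cover_sum_pos) auto
  moreover have "0 < (1 / \<epsilon>) powr - B" using eps by simp
  ultimately show ?thesis by linarith
qed

text \<open>
  Given covers \<open>U\<close> for \<open>dN N\<close> and \<open>V\<close> for \<open>dN M\<close>, the intersections of \<open>U i\<close> with the preimage of
  \<open>V j\<close> under \<open>T ^^ N\<close> form a cover for \<open>dN (N + M)\<close>, and the powers with base \<open>1 / \<epsilon> \<ge> 1\<close> turn the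
  inequality between the potentials into one between products.
\<close>

lemma cover_number_submult:
  assumes N: "1 \<le> N" and M: "1 \<le> M" and eps: "0 < \<epsilon>" "\<epsilon> \<le> 1"
    and cN: "continuous_map X euclideanreal \<phi>" and cM: "continuous_map X euclideanreal \<psi>"
    and cNM: "continuous_map X euclideanreal \<xi>"
    and sub: "\<And>x. x \<in> topspace X \<Longrightarrow> \<xi> x \<le> \<phi> x + \<psi> ((T ^^ N) x)"
  shows "cover_number X (dN (N + M)) \<xi> \<epsilon>
    \<le> cover_number X (dN N) \<phi> \<epsilon> * cover_number X (dN M) \<psi> \<epsilon>"
proof -
  let ?c = "cover_number X (dN (N + M)) \<xi> \<epsilon>"
  have prod: "?c \<le> (\<Sum>i<n. cover_term \<epsilon> \<phi> (U i)) * (\<Sum>j<m. cover_term \<epsilon> \<psi> (V j))"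
    if U: "\<And>i. i < n \<Longrightarrow> openin X (U i)" "\<And>i. i < n \<Longrightarrow> diam (dN N) (U i) < \<epsilon>"
        "(\<Union>i<n. U i) = topspace X"
      and V: "\<And>j. j < m \<Longrightarrow> openin X (V j)" "\<And>j. j < m \<Longrightarrow> diam (dN M) (V j) < \<epsilon>"
        "(\<Union>j<m. V j) = topspace X"
    for n m :: nat and U V :: "nat \<Rightarrow> 'a set"
  proof -
    define W where "W = (\<lambda>(i, j). U i \<inter> {x \<in> topspace X. (T ^^ N) x \<in> V j})"
    have W1: "openin X (W q) \<and> diam (dN (N + M)) (W q) < \<epsilon>" if q: "q \<in> {..<n} \<times> {..<m}" for q
    proof -
      obtain i j where ij: "q = (i, j)" "i < n" "j < m" using q by auto
      have UV: "U i \<subseteq> topspace X" "V j \<subseteq> topspace X" using ij U(3) V(3) by blast+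
      have "openin X (W q)"
        using ij U V iterate_cont[of N] unfolding W_def
        by (auto intro!: openin_Int openin_continuous_map_preimage)
      moreover have "diam (dN (N + M)) (W q) \<le> max (diam (dN N) (U i)) (diam (dN M) (V j))"
      proof (rule diam_le)
        fix x y assume xy: "x \<in> W q" "y \<in> W q"
        then have "dN N x y \<le> diam (dN N) (U i)"
          using UV by (intro dN_le_diam N) (auto simp: W_def ij)
        moreover have "dN M ((T ^^ N) x) ((T ^^ N) y) \<le> diam (dN M) (V j)"
          using UV xy by (intro dN_le_diam M) (auto simp: W_def ij)
        ultimately show "dN (N + M) x y \<le> max (diam (dN N) (U i)) (diam (dN M) (V j))"
          using dyn_metric_add[OF N M, of T d x y] by linarith
      qed (use diam_dN_nonneg[OF N UV(1)] in auto)
      ultimately show ?thesis using U(2)[OF ij(2)] V(2)[OF ij(3)] by linarith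
    qed
    have W2: "(\<Union>q\<in>{..<n} \<times> {..<m}. W q) = topspace X"
    proof
      show "(\<Union>q\<in>{..<n} \<times> {..<m}. W q) \<subseteq> topspace X" by (auto simp: W_def)
      show "topspace X \<subseteq> (\<Union>q\<in>{..<n} \<times> {..<m}. W q)"
      proof
        fix x assume x: "x \<in> topspace X"
        obtain i where "i < n" "x \<in> U i" using x U(3) by blast
        moreover obtain j where "j < m" "(T ^^ N) x \<in> V j" using iterate_in[OF x] V(3) by blast
        ultimately show "x \<in> (\<Union>q\<in>{..<n} \<times> {..<m}. W q)"
          using x by (intro UN_I[of "(i, j)"]) (auto simp: W_def)
      qed
    qed
    have W3: "cover_term \<epsilon> \<xi> (W (i, j)) \<le> cover_term \<epsilon> \<phi> (U i) * cover_term \<epsilon> \<psi> (V j)"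
      if ij: "i < n" "j < m" for i j
    proof (cases "W (i, j) = {}")
      case False
      have UV: "U i \<subseteq> topspace X" "V j \<subseteq> topspace X" using ij U(3) V(3) by blast+
      have ne: "U i \<noteq> {}" "V j \<noteq> {}" using False by (auto simp: W_def)
      have "(SUP x\<in>W (i, j). \<xi> x) \<le> (SUP x\<in>U i. \<phi> x) + (SUP x\<in>V j. \<psi> x)"
      proof (rule cSUP_least[OF False])
        fix x assume x: "x \<in> W (i, j)"
        then have "\<phi> x \<le> (SUP x\<in>U i. \<phi> x)" "\<psi> ((T ^^ N) x) \<le> (SUP x\<in>V j. \<psi> x)" "x \<in> topspace X"
          using UV by (auto intro!: le_SUP cN cM simp: W_def)
        then show "\<xi> x \<le> (SUP x\<in>U i. \<phi> x) + (SUP x\<in>V j. \<psi> x)" using sub[of x] by linarith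
      qed
      then have "(1 / \<epsilon>) powr (SUP x\<in>W (i, j). \<xi> x)
          \<le> (1 / \<epsilon>) powr ((SUP x\<in>U i. \<phi> x) + (SUP x\<in>V j. \<psi> x))"
        using eps by (intro powr_mono) auto
      then show ?thesis using False ne by (simp add: cover_term_def powr_add)
    qed (simp add: cover_term_def)
    have "?c \<le> (\<Sum>q\<in>{..<n} \<times> {..<m}. cover_term \<epsilon> \<xi> (W q))"
      using W1 W2 by (intro cover_number_le) auto
    also have "\<dots> = (\<Sum>i<n. \<Sum>j<m. cover_term \<epsilon> \<xi> (W (i, j)))"
      by (simp add: sum.cartesian_product)
    also have "\<dots> \<le> (\<Sum>i<n. \<Sum>j<m. cover_term \<epsilon> \<phi> (U i) * cover_term \<epsilon> \<psi> (V j))"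
      using W3 by (intro sum_mono) auto
    also have "\<dots> = (\<Sum>i<n. cover_term \<epsilon> \<phi> (U i)) * (\<Sum>j<m. cover_term \<epsilon> \<psi> (V j))"
      by (simp add: sum_product)
    finally show ?thesis .
  qed
  have posN: "0 < cover_number X (dN N) \<phi> \<epsilon>" by (rule cover_number_pos[OF N eps cN])
  have "?c / cover_number X (dN N) \<phi> \<epsilon> \<le> cover_number X (dN M) \<psi> \<epsilon>"
  proof (rule cover_number_ge[OF M eps(1)])
    fix m and V :: "nat \<Rightarrow> 'a set"
    assume V: "\<And>j. j < m \<Longrightarrow> openin X (V j)" "\<And>j. j < m \<Longrightarrow> diam (dN M) (V j) < \<epsilon>"
        "(\<Union>j<m. V j) = topspace X"
    let ?V = "\<Sum>j<m. cover_term \<epsilon> \<psi> (V j)"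
    obtain B where "\<And>x. x \<in> topspace X \<Longrightarrow> \<bar>\<psi> x\<bar> \<le> B" using cont_bounded[OF cM] by blast
    then have "\<And>x. x \<in> topspace X \<Longrightarrow> - B \<le> \<psi> x" by fastforce
    from cover_sum_pos[OF V(3) eps(1) cM eps(2) this] have "(1 / \<epsilon>) powr - B \<le> ?V" .
    moreover have "0 < (1 / \<epsilon>) powr - B" using eps by simp
    ultimately have "0 < ?V" by linarith
    have "?c / ?V \<le> cover_number X (dN N) \<phi> \<epsilon>"
      using prod[OF _ _ _ V] \<open>0 < ?V\<close>
      by (intro cover_number_ge[OF N eps(1)]) (simp add: pos_divide_le_eq)
    then show "?c / cover_number X (dN N) \<phi> \<epsilon> \<le> ?V"
      using posN \<open>0 < ?V\<close> by (simp add: field_simps)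
  qed
  then show ?thesis using posN by (simp add: field_simps)
qed

end

section \<open>Hausdorff dimension against covering numbers\<close>

lemma hausdorff_term_nonneg: "0 \<le> hausdorff_term d \<phi> s E"
  by (simp add: hausdorff_term_def)

lemma hausdorff_content_antimono:
  assumes "\<delta> \<le> \<epsilon>"
  shows "hausdorff_content X d \<phi> \<epsilon> s \<le> hausdorff_content X d \<phi> \<delta> s"
  unfolding hausdorff_content_def
proof (rule Inf_superset_mono)
  show "{\<Sum>i. ennreal (hausdorff_term d \<phi> s (E i)) | E. (\<Union>i::nat. E i) = topspace X \<and> (\<forall>i. diam d (E i) < \<delta>)}
    \<subseteq> {\<Sum>i. ennreal (hausdorff_term d \<phi> s (E i)) | E. (\<Union>i::nat. E i) = topspace X \<and> (\<forall>i. diam d (E i) < \<epsilon>)}"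
    using assms by (intro Collect_mono ex_mono impI) (auto intro: less_le_trans)
qed

lemma dim_H_antimono:
  assumes "\<delta> \<le> \<epsilon>"
  shows "dim_H X d \<phi> \<epsilon> \<le> dim_H X d \<phi> \<delta>"
  unfolding dim_H_def
  by (intro Sup_subset_mono) (auto intro: order_trans[OF _ hausdorff_content_antimono[OF assms]])

lemma mdim_H_eq:
  "mdim_H X T d \<phi> =
    (SUP \<epsilon>\<in>{0<..}. limsup (\<lambda>N. dim_H X (dyn_metric T d N) (\<phi> N) \<epsilon> / ereal (real N)))"
proof -
  have "(\<lambda>N. dim_H X (dyn_metric T d N) (\<phi> N) y / ereal (real N)) N
      \<le> (\<lambda>N. dim_H X (dyn_metric T d N) (\<phi> N) x / ereal (real N)) N" if "1 \<le> N" "x \<le> y" for x y N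
    using that by (auto intro!: ereal_divide_right_mono dim_H_antimono)
  then have "limsup (\<lambda>N. dim_H X (dyn_metric T d N) (\<phi> N) y / ereal (real N))
      \<le> limsup (\<lambda>N. dim_H X (dyn_metric T d N) (\<phi> N) x / ereal (real N))" if "x \<le> y" for x y
    using that by (intro Limsup_mono eventually_sequentiallyI[of 1]) auto
  then show ?thesis
    unfolding mdim_H_def by (intro tendsto_Lim tendsto_SUP_at_right_0) auto
qed

context compact_system
begin

text \<open>
  In a Hausdorff sum over an open cover, replace each diameter by \<open>\<epsilon>\<close>; the exponents are nonnegative.
  The sum becomes \<open>\<epsilon> powr s\<close> times the covering sum, so \<open>H \<ge> 1\<close> forces \<open>(1 / \<epsilon>) powr s\<close> to be at most the
  covering number.
\<close>

lemma dim_H_le_cover_number: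
  assumes N: "1 \<le> N" and \<phi>: "continuous_map X euclideanreal \<phi>" and eps: "0 < \<epsilon>" "\<epsilon> < 1"
  shows "dim_H X (dN N) \<phi> \<epsilon> \<le> ereal (ln (cover_number X (dN N) \<phi> \<epsilon>) / ln (1 / \<epsilon>))"
  unfolding dim_H_def
proof (rule Sup_least, clarify)
  fix s assume s: "(SUP x\<in>topspace X. \<phi> x) \<le> s" and H: "1 \<le> hausdorff_content X (dN N) \<phi> \<epsilon> s"
  have "(1 / \<epsilon>) powr s \<le> cover_number X (dN N) \<phi> \<epsilon>"
  proof (rule cover_number_ge[OF N eps(1)])
    fix n and U :: "nat \<Rightarrow> 'a set"
    assume U: "\<And>i. i < n \<Longrightarrow> openin X (U i)" "\<And>i. i < n \<Longrightarrow> diam (dN N) (U i) < \<epsilon>"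
      "(\<Union>i<n. U i) = topspace X"
    define E where "E i = (if i < n then U i else {})" for i
    have "(\<Union>i. E i) = topspace X" unfolding E_def U(3)[symmetric] by (auto split: if_splits)
    moreover have "diam (dN N) (E i) < \<epsilon>" for i
      using U(2)[of i] eps by (simp add: E_def)
    ultimately have "hausdorff_content X (dN N) \<phi> \<epsilon> s \<le> (\<Sum>i. ennreal (hausdorff_term (dN N) \<phi> s (E i)))"
      unfolding hausdorff_content_def by (intro Inf_lower) blast
    also have "\<dots> = (\<Sum>i<n. ennreal (hausdorff_term (dN N) \<phi> s (E i)))"
      by (rule suminf_finite) (auto simp: E_def hausdorff_term_def)
    also have "\<dots> = ennreal (\<Sum>i<n. hausdorff_term (dN N) \<phi> s (E i))"
      using hausdorff_term_nonneg by (intro sum_ennreal) auto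
    finally have "1 \<le> ennreal (\<Sum>i<n. hausdorff_term (dN N) \<phi> s (E i))" using H by (rule order_trans[rotated])
    then have "1 \<le> (\<Sum>i<n. hausdorff_term (dN N) \<phi> s (E i))"
      by (metis ennreal_1 ennreal_le_iff2 not_one_le_zero)
    also have "\<dots> \<le> (\<Sum>i<n. \<epsilon> powr s * cover_term \<epsilon> \<phi> (U i))"
    proof (rule sum_mono)
      fix i assume "i \<in> {..<n}"
      then have i: "i < n" by simp
      show "hausdorff_term (dN N) \<phi> s (E i) \<le> \<epsilon> powr s * cover_term \<epsilon> \<phi> (U i)"
      proof (cases "U i = {}")
        case False
        have UX: "U i \<subseteq> topspace X" using i U(3) by blast
        define \<sigma> where "\<sigma> = (SUP x\<in>U i. \<phi> x)"
        have "\<sigma> \<le> (SUP x\<in>topspace X. \<phi> x)"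
          unfolding \<sigma>_def using False UX by (intro cSUP_subset_mono cont_bdd_above \<phi>) auto
        then have "\<sigma> \<le> s" using s by linarith
        have "\<epsilon> powr s * cover_term \<epsilon> \<phi> (U i) = \<epsilon> powr (s - \<sigma>)"
          using False eps
          by (simp add: cover_term_def \<sigma>_def[symmetric] powr_diff powr_divide)
        moreover have "diam (dN N) (U i) powr (s - \<sigma>) \<le> \<epsilon> powr (s - \<sigma>)"
          using \<open>\<sigma> \<le> s\<close> diam_dN_nonneg[OF N UX] U(2)[OF i] by (intro powr_mono2) auto
        moreover have "\<epsilon> powr (s - \<sigma>) = 1" if "s - \<sigma> = 0" using that eps by simp
        ultimately show ?thesis
          using False i by (auto simp: hausdorff_term_def E_def \<sigma>_def[symmetric])
      qed (simp add: E_def hausdorff_term_def cover_term_def)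
    qed
    finally have "1 \<le> \<epsilon> powr s * (\<Sum>i<n. cover_term \<epsilon> \<phi> (U i))" by (simp add: sum_distrib_left)
    then show "(1 / \<epsilon>) powr s \<le> (\<Sum>i<n. cover_term \<epsilon> \<phi> (U i))"
      using eps by (simp add: powr_divide field_simps)
  qed
  then have "ln ((1 / \<epsilon>) powr s) \<le> ln (cover_number X (dN N) \<phi> \<epsilon>)"
    using eps cover_number_pos[OF N _ _ \<phi>, of \<epsilon>] by (subst ln_le_cancel_iff) auto
  then have "s * ln (1 / \<epsilon>) \<le> ln (cover_number X (dN N) \<phi> \<epsilon>)"
    using eps by (simp add: ln_powr)
  moreover have "0 < ln (1 / \<epsilon>)" using eps by simp
  ultimately show "ereal s \<le> ereal (ln (cover_number X (dN N) \<phi> \<epsilon>) / ln (1 / \<epsilon>))"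
    by (simp only: ereal_less_eq pos_le_divide_eq)
qed

text \<open>
  At the exponent \<open>s = max \<phi>\<close>, any member of a cover that contains a maximum point of \<open>\<phi>\<close> has exponent 0
  and contributes 1, also when its diameter is 0.
\<close>

lemma SUP_le_dim_H:
  assumes N: "1 \<le> N" and \<phi>: "continuous_map X euclideanreal \<phi>"
  shows "ereal (SUP x\<in>topspace X. \<phi> x) \<le> dim_H X (dN N) \<phi> \<epsilon>"
proof -
  let ?s = "SUP x\<in>topspace X. \<phi> x"
  have "continuous_map X euclideanreal (\<lambda>x. - \<phi> x)" using \<phi> by (intro continuous_intros)
  from continuous_map_attains_inf[OF compact closedin_topspace nonempty this]
  obtain z where "z \<in> topspace X" "\<forall>x\<in>topspace X. - \<phi> z \<le> - \<phi> x" by blast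
  then have z: "z \<in> topspace X" "\<And>x. x \<in> topspace X \<Longrightarrow> \<phi> x \<le> \<phi> z" by auto
  have s: "?s = \<phi> z" using z by (intro cSup_eq_maximum) auto
  have "1 \<le> hausdorff_content X (dN N) \<phi> \<epsilon> ?s"
    unfolding hausdorff_content_def
  proof (rule Inf_greatest, clarify)
    fix E :: "nat \<Rightarrow> 'a set"
    assume E: "(\<Union>i. E i) = topspace X"
    then obtain i where i: "z \<in> E i" using z(1) by blast
    have "(SUP x\<in>E i. \<phi> x) = \<phi> z" using z i E by (intro cSup_eq_maximum) auto
    then have "hausdorff_term (dN N) \<phi> ?s (E i) = 1"
      using i s by (auto simp: hausdorff_term_def)
    then have "1 = ennreal (hausdorff_term (dN N) \<phi> ?s (E i))" by simp
    also have "\<dots> = (\<Sum>j\<in>{i}. ennreal (hausdorff_term (dN N) \<phi> ?s (E j)))" by simp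
    also have "\<dots> \<le> (\<Sum>j. ennreal (hausdorff_term (dN N) \<phi> ?s (E j)))"
      by (rule sum_le_suminf) auto
    finally show "1 \<le> (\<Sum>j. ennreal (hausdorff_term (dN N) \<phi> ?s (E j)))" .
  qed
  then show ?thesis unfolding dim_H_def by (intro Sup_upper) blast
qed

lemma mdim_H_le_lower_mdim_M:
  assumes \<phi>: "subadditive_potential X T \<phi>"
  shows "mdim_H X T d \<phi> \<le> lower_mdim_M X T d \<phi>"
proof -
  have cont: "continuous_map X euclideanreal (\<phi> n)" if "1 \<le> n" for n
    using \<phi> that by (simp add: subadditive_potential_def)
  have sub: "\<phi> (n + m) x \<le> \<phi> n x + \<phi> m ((T ^^ n) x)" if "1 \<le> n" "1 \<le> m" "x \<in> topspace X" for n m x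
    using \<phi> that by (simp add: subadditive_potential_def)
  let ?h = "\<lambda>\<epsilon>. limsup (\<lambda>N. dim_H X (dN N) (\<phi> N) \<epsilon> / ereal (real N))"
  \<comment> \<open>Logarithms of covering numbers are subadditive in \<open>N\<close>, so the limit in \<open>eps_pressure\<close> exists and
    may be compared with a limes superior.\<close>
  have le: "?h \<epsilon> \<le> eps_pressure X T d \<phi> \<epsilon> / ereal (ln (1 / \<epsilon>))" if eps: "0 < \<epsilon>" "\<epsilon> < 1" for \<epsilon>
  proof -
    define a where "a N = ln (cover_number X (dN N) (\<phi> N) \<epsilon>)" for N
    have pos: "0 < cover_number X (dN N) (\<phi> N) \<epsilon>" if "1 \<le> N" for N
      using cover_number_pos[OF that _ _ cont[OF that]] eps by simp
    have "a (N + M) \<le> a N + a M" if "1 \<le> N" "1 \<le> M" for N M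
    proof -
      have "cover_number X (dN (N + M)) (\<phi> (N + M)) \<epsilon>
          \<le> cover_number X (dN N) (\<phi> N) \<epsilon> * cover_number X (dN M) (\<phi> M) \<epsilon>"
        using eps that cont sub by (intro cover_number_submult) auto
      then have "a (N + M) \<le> ln (cover_number X (dN N) (\<phi> N) \<epsilon> * cover_number X (dN M) (\<phi> M) \<epsilon>)"
        unfolding a_def using pos that by (subst ln_le_cancel_iff) auto
      also have "\<dots> = a N + a M"
        unfolding a_def using pos[OF that(1)] pos[OF that(2)] by (intro ln_mult_pos)
      finally show ?thesis .
    qed
    from fekete_ereal[OF this] obtain l where l: "(\<lambda>n. ereal (a n / real n)) \<longlonglongrightarrow> l" by blast
    then have P: "eps_pressure X T d \<phi> \<epsilon> = l"
      unfolding eps_pressure_def a_def[symmetric] by (rule limI)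
    have ln_pos: "0 < ln (1 / \<epsilon>)" using eps by simp
    have "(\<lambda>N. ereal (1 / ln (1 / \<epsilon>)) * ereal (a N / real N)) \<longlonglongrightarrow> ereal (1 / ln (1 / \<epsilon>)) * l"
      by (intro tendsto_cmult_ereal l) auto
    moreover have "ereal (1 / ln (1 / \<epsilon>)) * l = l / ereal (ln (1 / \<epsilon>))"
      using ln_pos by (simp add: divide_ereal_def mult.commute inverse_eq_divide)
    ultimately have lim: "limsup (\<lambda>N. ereal (1 / ln (1 / \<epsilon>)) * ereal (a N / real N)) = l / ereal (ln (1 / \<epsilon>))"
      by (metis lim_imp_Limsup trivial_limit_sequentially)
    have "?h \<epsilon> \<le> limsup (\<lambda>N. ereal (1 / ln (1 / \<epsilon>)) * ereal (a N / real N))"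
    proof (intro Limsup_mono eventually_sequentiallyI[of 1])
      fix N :: nat assume N: "1 \<le> N"
      have "dim_H X (dN N) (\<phi> N) \<epsilon> / ereal (real N) \<le> ereal (a N / ln (1 / \<epsilon>)) / ereal (real N)"
        unfolding a_def using N eps dim_H_le_cover_number[OF N cont[OF N]]
        by (intro ereal_divide_right_mono) auto
      also have "\<dots> = ereal (1 / ln (1 / \<epsilon>)) * ereal (a N / real N)"
        using N by simp
      finally show "dim_H X (dN N) (\<phi> N) \<epsilon> / ereal (real N)
          \<le> ereal (1 / ln (1 / \<epsilon>)) * ereal (a N / real N)" .
    qed
    then show ?thesis unfolding lim P .
  qed
  have "(?h \<longlongrightarrow> mdim_H X T d \<phi>) (at_right 0)"
    unfolding mdim_H_eq
  proof (rule tendsto_SUP_at_right_0)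
    fix x y :: real assume "x \<le> y"
    then show "?h y \<le> ?h x"
      by (intro Limsup_mono eventually_sequentiallyI[of 1] ereal_divide_right_mono dim_H_antimono) auto
  qed
  then have "mdim_H X T d \<phi> = Liminf (at_right 0) ?h"
    by (intro lim_imp_Liminf[symmetric]) (auto simp: trivial_limit_at_right_real)
  also have "\<dots> \<le> lower_mdim_M X T d \<phi>"
    unfolding lower_mdim_M_def using le
    by (intro Liminf_mono eventually_at_rightI[of 0 1]) auto
  finally show ?thesis .
qed

end

section \<open>Width dimension against Hausdorff dimension\<close>

lemma Widim_antimono:
  assumes "\<delta> \<le> \<epsilon>"
  shows "Widim X d \<phi> \<epsilon> \<le> Widim X d \<phi> \<delta>"
  unfolding Widim_def using assms
  by (intro Inf_superset_mono Collect_mono ex_mono impI)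
    (auto simp: eps_embedding_def intro: less_le_trans)

lemma Widim_lessE:
  assumes "Widim X d \<phi> \<epsilon> < ereal p"
  obtains K f where "finite_complex K" "eps_embedding X d \<epsilon> (polyhedron_top K) f"
    "\<And>x. x \<in> topspace X \<Longrightarrow> real (local_dim K (f x)) + \<phi> x \<le> p"
proof -
  obtain K f where K: "finite_complex K" "eps_embedding X d \<epsilon> (polyhedron_top K) f"
    and less: "(SUP x \<in> topspace X. ereal (real (local_dim K (f x)) + \<phi> x)) < ereal p"
    using assms unfolding Widim_def Inf_less_iff by blast
  have "ereal (real (local_dim K (f x)) + \<phi> x) < ereal p" if "x \<in> topspace X" for x
    using less SUP_upper[OF that, of "\<lambda>x. ereal (real (local_dim K (f x)) + \<phi> x)"]
    by (rule le_less_trans[rotated])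
  then have "real (local_dim K (f x)) + \<phi> x \<le> p" if "x \<in> topspace X" for x
    using that by (simp add: less_imp_le)
  from that[OF K this] show ?thesis .
qed

context compact_system
begin

text \<open>
  Uniform continuity of the identity from \<open>d\<close> to \<open>d'\<close>: \<open>\<eta>\<close> is a Lebesgue number for the cover by
  \<open>d'\<close>-balls of radius \<open>e / 2\<close>.
\<close>

lemma compatible_metric_uniformly_small:
  assumes d': "compatible_metric X d'" and e: "0 < e"
  obtains \<eta> where "0 < \<eta>"
    "\<And>x y. x \<in> topspace X \<Longrightarrow> y \<in> topspace X \<Longrightarrow> d x y < \<eta> \<Longrightarrow> d' x y \<le> e"
proof -
  interpret D: compact_system X T d'
    using dyn d' nonempty by unfold_locales
  let ?ball = "\<lambda>p. {x \<in> topspace X. d' p x < e / 2}"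
  have op: "openin X (?ball p)" if "p \<in> topspace X" for p
    using D.openin_dN_ball[of 1, OF _ that] by (simp only: dyn_metric_1)
  have "\<exists>\<epsilon>>0. \<forall>x\<in>topspace X. \<exists>U\<in>?ball ` topspace X. mball x \<epsilon> \<subseteq> U"
  proof (rule lebesgue_number)
    show "compactin mtopology (topspace X)" using compact by (simp add: mtopology_eq compact_space_def)
    show "topspace X \<subseteq> \<Union>(?ball ` topspace X)"
      using e by (force simp: D.mdist_zero)
    show "\<And>U. U \<in> ?ball ` topspace X \<Longrightarrow> openin mtopology U" using op by (auto simp: mtopology_eq)
  qed
  then obtain \<eta> where \<eta>: "0 < \<eta>"
    "\<And>x. x \<in> topspace X \<Longrightarrow> \<exists>p\<in>topspace X. mball x \<eta> \<subseteq> ?ball p" by blast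
  show ?thesis
  proof (rule that[OF \<eta>(1)])
    fix x y assume xy: "x \<in> topspace X" "y \<in> topspace X" "d x y < \<eta>"
    obtain p where p: "p \<in> topspace X" "mball x \<eta> \<subseteq> ?ball p" using \<eta>(2)[OF xy(1)] by blast
    have "x \<in> mball x \<eta>" "y \<in> mball x \<eta>" using xy \<eta>(1) by (auto simp: in_mball)
    then have "x \<in> ?ball p" "y \<in> ?ball p" using p(2) by blast+
    then have "d' p x < e / 2" "d' p y < e / 2" by simp_all
    then show "d' x y \<le> e"
      using D.dN_triangle[of 1 x y p "e / 2"] xy p unfolding dyn_metric_1 by simp
  qed
qed

text \<open>
  A Lipschitz cut-off that is 1 on the ball of radius \<open>\<eta> / 4\<close> around \<open>p\<close> and 0 outside the ball of radius
  \<open>\<eta> / 2\<close>.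
\<close>

definition bump :: "real \<Rightarrow> 'a \<Rightarrow> 'a \<Rightarrow> real" where
  "bump \<eta> p x = max 0 (min 1 (2 - 4 / \<eta> * d p x))"

lemma bump_cont: "p \<in> topspace X \<Longrightarrow> continuous_map X euclideanreal (bump \<eta> p)"
  unfolding bump_def by (intro continuous_intros dist_cont)

lemma bump_lipschitz:
  assumes "0 < \<eta>" "p \<in> topspace X" "x \<in> topspace X" "y \<in> topspace X"
  shows "\<bar>bump \<eta> p x - bump \<eta> p y\<bar> \<le> 4 / \<eta> * d x y"
proof -
  have "\<bar>d p x - d p y\<bar> \<le> d x y"
    using triangle[of p x y] triangle[of p y x] assms by (auto simp: commute)
  then have "4 / \<eta> * \<bar>d p x - d p y\<bar> \<le> 4 / \<eta> * d x y"
    using assms(1) by (intro mult_left_mono) auto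
  moreover have "\<bar>4 / \<eta> * d p x - 4 / \<eta> * d p y\<bar> = 4 / \<eta> * \<bar>d p x - d p y\<bar>"
    using assms(1) by (simp only: right_diff_distrib[symmetric] abs_mult) simp
  ultimately show ?thesis unfolding bump_def by linarith
qed

lemma bump_separates:
  assumes "0 < \<eta>" "p \<in> topspace X" "x \<in> topspace X" "y \<in> topspace X"
    and "d p x < \<eta> / 4" "\<eta> \<le> d x y"
  shows "bump \<eta> p x = 1" "bump \<eta> p y = 0"
proof -
  have "\<eta> / 2 \<le> d p y" using triangle[of x p y] assms by (simp add: commute)
  then have "2 \<le> 4 / \<eta> * d p y" using assms(1) by (simp add: field_simps)
  then show "bump \<eta> p y = 0" by (simp add: bump_def)
  have "4 / \<eta> * d p x \<le> 1" using assms by (simp add: field_simps)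
  then show "bump \<eta> p x = 1" by (simp add: bump_def)
qed

text \<open>
  The coordinates are the cut-offs around the net \<open>P\<close> at the first \<open>N\<close> points of the orbit.  If
  \<open>dN N x y \<ge> \<eta>\<close>, then the orbits are \<open>\<eta>\<close>-apart at some time \<open>n < N\<close>, and the cut-off around a net point
  near the orbit of \<open>x\<close> at that time separates them.
\<close>

lemma Widim_le_count:
  assumes N: "1 \<le> N" and \<eta>: "0 < \<eta>" and eps: "0 < \<epsilon>" and \<phi>: "continuous_map X euclideanreal \<phi>"
    and P: "finite P" "P \<subseteq> topspace X" "\<And>x. x \<in> topspace X \<Longrightarrow> \<exists>p\<in>P. d p x < \<eta> / 4"
    and near: "\<And>x y. x \<in> topspace X \<Longrightarrow> y \<in> topspace X \<Longrightarrow> dN N x y < \<eta> \<Longrightarrow>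
        \<phi> x \<le> \<phi> y + v \<and> D x y \<le> \<epsilon> / 2"
    and t: "\<And>i. i \<in> {..<N} \<times> P \<Longrightarrow> 0 < t i \<and> t i < 1"
    and count: "\<And>x. x \<in> topspace X \<Longrightarrow>
        real (card {i \<in> {..<N} \<times> P. bump \<eta> (snd i) ((T ^^ fst i) x) = t i}) + \<phi> x < c"
  shows "Widim X D \<phi> \<epsilon> \<le> ereal (c + v)"
proof (rule Widim_le_of_separating_functions[OF compact _ eps _ \<phi> t _ count])
  show "finite ({..<N} \<times> P)" using P(1) by simp
next
  fix i assume "i \<in> {..<N} \<times> P"
  then have "snd i \<in> topspace X" using P(2) by auto
  from continuous_map_compose[OF iterate_cont bump_cont[OF this]]
  show "continuous_map X euclideanreal (\<lambda>x. bump \<eta> (snd i) ((T ^^ fst i) x))" by (simp add: o_def)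
next
  fix x y assume xy: "x \<in> topspace X" "y \<in> topspace X"
    and nosep: "\<forall>i\<in>{..<N} \<times> P. \<not> (bump \<eta> (snd i) ((T ^^ fst i) x) = 1 \<and> bump \<eta> (snd i) ((T ^^ fst i) y) = 0)"
  have "d ((T ^^ n) x) ((T ^^ n) y) < \<eta>" if "n < N" for n
  proof (rule ccontr)
    assume far: "\<not> ?thesis"
    obtain p where p: "p \<in> P" "d p ((T ^^ n) x) < \<eta> / 4" using P(3) iterate_in[OF xy(1)] by blast
    then have "bump \<eta> p ((T ^^ n) x) = 1" "bump \<eta> p ((T ^^ n) y) = 0"
      using far P(2) iterate_in xy \<eta> bump_separates[of \<eta> p "(T ^^ n) x" "(T ^^ n) y"] by auto
    moreover have "(n, p) \<in> {..<N} \<times> P" using that p by simp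
    ultimately show False using nosep by fastforce
  qed
  then show "\<phi> x \<le> \<phi> y + v \<and> D x y \<le> \<epsilon> / 2"
    using near[OF xy] N by (simp add: dyn_metric_less_iff)
qed

text \<open>
  Finiteness, needed to apply Fekete's lemma to real sequences: any \<open>t\<close> gives an upper bound by the
  number of all coordinates, and local dimensions are nonnegative.
\<close>

lemma Widim_real:
  assumes N: "1 \<le> N" and eps: "0 < \<epsilon>" and \<phi>: "continuous_map X euclideanreal \<phi>"
  obtains r where "Widim X (dN N) \<phi> \<epsilon> = ereal r"
proof -
  obtain B where B: "\<And>x. x \<in> topspace X \<Longrightarrow> \<bar>\<phi> x\<bar> \<le> B" using cont_bounded[OF \<phi>] by blast
  obtain P where P: "finite P" "P \<subseteq> topspace X" "\<And>x. x \<in> topspace X \<Longrightarrow> \<exists>p\<in>P. d p x < (\<epsilon> / 2) / 4"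
    using finite_net[of 1 "\<epsilon> / 2 / 4"] eps unfolding dyn_metric_1 by auto
  have "Widim X (dN N) \<phi> \<epsilon> \<le> ereal ((real (card ({..<N} \<times> P)) + B + 1) + 2 * B)"
  proof (rule Widim_le_count[OF N _ eps \<phi> P, of "2 * B" "dN N" "\<lambda>_. 1 / 2"])
    fix x y assume "x \<in> topspace X" "y \<in> topspace X" "dN N x y < \<epsilon> / 2"
    then show "\<phi> x \<le> \<phi> y + 2 * B \<and> dN N x y \<le> \<epsilon> / 2" using B[of x] B[of y] by linarith
  next
    fix x assume x: "x \<in> topspace X"
    have "card {i \<in> {..<N} \<times> P. bump (\<epsilon> / 2) (snd i) ((T ^^ fst i) x) = 1 / 2} \<le> card ({..<N} \<times> P)"
      using P(1) by (intro card_mono) auto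
    then show "real (card {i \<in> {..<N} \<times> P. bump (\<epsilon> / 2) (snd i) ((T ^^ fst i) x) = 1 / 2}) + \<phi> x
        < real (card ({..<N} \<times> P)) + B + 1"
      using B[OF x] by linarith
  qed (use eps in auto)
  moreover have "ereal (- B) \<le> Widim X (dN N) \<phi> \<epsilon>"
    unfolding Widim_def
  proof (rule Inf_greatest, clarify)
    fix K f
    obtain x where x: "x \<in> topspace X" using nonempty by blast
    have "ereal (- B) \<le> ereal (real (local_dim K (f x)) + \<phi> x)" using B[OF x] by simp
    also have "\<dots> \<le> (SUP x\<in>topspace X. ereal (real (local_dim K (f x)) + \<phi> x))"
      using x by (rule SUP_upper)
    finally show "ereal (- B) \<le> (SUP x\<in>topspace X. ereal (real (local_dim K (f x)) + \<phi> x))" .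
  qed
  ultimately show ?thesis using that by (cases "Widim X (dN N) \<phi> \<epsilon>") auto
qed

lemma Widim_subadditive:
  assumes N: "1 \<le> N" and M: "1 \<le> M" and eps: "0 < \<epsilon>"
    and sub: "\<And>x. x \<in> topspace X \<Longrightarrow> \<xi> x \<le> \<phi> x + \<psi> ((T ^^ N) x)"
    and p: "Widim X (dN N) \<phi> \<epsilon> < ereal p" and q: "Widim X (dN M) \<psi> \<epsilon> < ereal q"
  shows "Widim X (dN (N + M)) \<xi> \<epsilon> \<le> ereal (p + q)"
proof -
  obtain K f where K: "finite_complex K" "eps_embedding X (dN N) \<epsilon> (polyhedron_top K) f"
    "\<And>x. x \<in> topspace X \<Longrightarrow> real (local_dim K (f x)) + \<phi> x \<le> p" using Widim_lessE[OF p] by blast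
  obtain L g where L: "finite_complex L" "eps_embedding X (dN M) \<epsilon> (polyhedron_top L) g"
    "\<And>x. x \<in> topspace X \<Longrightarrow> real (local_dim L (g x)) + \<psi> x \<le> q" using Widim_lessE[OF q] by blast
  obtain B1 where B1: "\<And>x y. x \<in> topspace X \<Longrightarrow> y \<in> topspace X \<Longrightarrow> dN N x y \<le> B1"
    using dN_bounded[OF N] by blast
  obtain B2 where B2: "\<And>x y. x \<in> topspace X \<Longrightarrow> y \<in> topspace X \<Longrightarrow> dN M x y \<le> B2"
    using dN_bounded[OF M] by blast
  show ?thesis
    by (rule Widim_product[OF iterate_cont eps K(1,2) L(1,2) B1 B2 _ K(3) L(3) sub])
      (auto simp: dyn_metric_add[OF N M])
qed

lemma Widim_convergent:
  assumes \<phi>: "subadditive_potential X T \<phi>" and eps: "0 < \<epsilon>"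
  shows "convergent (\<lambda>N. Widim X (dN N) (\<phi> N) \<epsilon> / ereal (real N))"
proof -
  have cont: "continuous_map X euclideanreal (\<phi> n)" if "1 \<le> n" for n
    using \<phi> that by (simp add: subadditive_potential_def)
  define a where "a N = real_of_ereal (Widim X (dN N) (\<phi> N) \<epsilon>)" for N
  have a: "Widim X (dN N) (\<phi> N) \<epsilon> = ereal (a N)" if N: "1 \<le> N" for N
    using Widim_real[OF N eps cont[OF N]] unfolding a_def by (metis real_of_ereal.simps(1))
  have "a (N + M) \<le> a N + a M" if NM: "1 \<le> N" "1 \<le> M" for N M
  proof (rule field_le_epsilon)
    fix e :: real assume "0 < e"
    have "Widim X (dN (N + M)) (\<phi> (N + M)) \<epsilon> \<le> ereal ((a N + e / 2) + (a M + e / 2))"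
      using \<phi> NM \<open>0 < e\<close> a
      by (intro Widim_subadditive[OF NM eps, of _ "\<phi> N" "\<phi> M"]) (auto simp: subadditive_potential_def)
    then show "a (N + M) \<le> a N + a M + e" using a[of "N + M"] NM by simp
  qed
  from fekete_ereal[OF this] obtain l where "(\<lambda>n. ereal (a n / real n)) \<longlonglongrightarrow> l" by blast
  moreover have "\<forall>\<^sub>F n in sequentially. ereal (a n / real n) = Widim X (dN n) (\<phi> n) \<epsilon> / ereal (real n)"
    using a by (intro eventually_sequentiallyI[of 1]) auto
  ultimately have "(\<lambda>n. Widim X (dN n) (\<phi> n) \<epsilon> / ereal (real n)) \<longlonglongrightarrow> l"
    by (rule Lim_transform_eventually)
  then show ?thesis by (rule convergentI)
qed

lemma mdim_eq:
  assumes \<phi>: "subadditive_potential X T \<phi>"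
  shows "mdim X T d \<phi> = (SUP \<epsilon>\<in>{0<..}. lim (\<lambda>N. Widim X (dN N) (\<phi> N) \<epsilon> / ereal (real N)))"
  unfolding mdim_def
proof (intro tendsto_Lim tendsto_SUP_at_right_0)
  fix x y :: real assume xy: "0 < x" "x \<le> y"
  have "(\<lambda>N. Widim X (dN N) (\<phi> N) \<epsilon> / ereal (real N))
      \<longlonglongrightarrow> lim (\<lambda>N. Widim X (dN N) (\<phi> N) \<epsilon> / ereal (real N))" if "0 < \<epsilon>" for \<epsilon>
    using Widim_convergent[OF \<phi> that] by (simp add: convergent_LIMSEQ_iff)
  then have "(\<lambda>N. Widim X (dN N) (\<phi> N) y / ereal (real N))
      \<longlonglongrightarrow> lim (\<lambda>N. Widim X (dN N) (\<phi> N) y / ereal (real N))"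
    and "(\<lambda>N. Widim X (dN N) (\<phi> N) x / ereal (real N))
      \<longlonglongrightarrow> lim (\<lambda>N. Widim X (dN N) (\<phi> N) x / ereal (real N))"
    using xy by auto
  then show "lim (\<lambda>N. Widim X (dN N) (\<phi> N) y / ereal (real N))
      \<le> lim (\<lambda>N. Widim X (dN N) (\<phi> N) x / ereal (real N))"
    by (rule LIMSEQ_le) (use xy in \<open>auto intro!: exI[of _ 1] ereal_divide_right_mono Widim_antimono\<close>)
qed simp

text \<open>
  The quantitative heart of the second inequality.  The loss \<open>\<tau> * N\<close> pays for the number of coordinates
  and for their Lipschitz constant; the condition \<open>small\<close> on \<open>\<delta>\<close> does not involve \<open>N\<close>.
\<close>

lemma Widim_le_dim_H:
  assumes N: "1 \<le> N" and \<eta>: "0 < \<eta>" and eps: "0 < \<epsilon>" and \<phi>: "continuous_map X euclideanreal \<phi>"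
    and P: "finite P" "P \<subseteq> topspace X" "\<And>x. x \<in> topspace X \<Longrightarrow> \<exists>p\<in>P. d p x < \<eta> / 4"
    and near: "\<And>x y. x \<in> topspace X \<Longrightarrow> y \<in> topspace X \<Longrightarrow> dN N x y < \<eta> \<Longrightarrow>
        \<phi> x \<le> \<phi> y + v \<and> D x y \<le> \<epsilon> / 2"
    and \<tau>: "0 < \<tau>" and \<delta>: "0 < \<delta>" "\<delta> < 1"
    and small: "(2 * max 1 (8 / \<eta>)) ^ card P * \<delta> powr \<tau> \<le> 1"
  shows "Widim X D \<phi> \<epsilon> \<le> dim_H X (dN N) \<phi> \<delta> + ereal (\<tau> * real N + v)"
proof -
  let ?I = "{..<N} \<times> P"
  define \<Lambda> where "\<Lambda> = max 1 (8 / \<eta>)"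
  define c where "c = \<tau> * real N"
  have c: "0 < c" using N \<tau> by (simp add: c_def)
  have I: "finite ?I" "card ?I = card P * N" using P(1) by (auto simp: card_cartesian_product)
  have small_N: "(2 * \<Lambda>) ^ card ?I * \<delta> powr c \<le> 1"
  proof -
    have "\<delta> powr c = (\<delta> powr \<tau>) ^ N" using \<delta> by (simp add: c_def powr_powr[symmetric] powr_realpow)
    then have "(2 * \<Lambda>) ^ card ?I * \<delta> powr c = ((2 * \<Lambda>) ^ card P * \<delta> powr \<tau>) ^ N"
      by (simp add: I power_mult power_mult_distrib)
    also have "\<dots> \<le> 1" using small by (intro power_le_one) (auto simp: \<Lambda>_def)
    finally show ?thesis .
  qed
  have main: "Widim X D \<phi> \<epsilon> \<le> ereal (s + (c + v))" if s: "dim_H X (dN N) \<phi> \<delta> < ereal s" for s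
  proof -
    have s_ge: "(SUP x\<in>topspace X. \<phi> x) \<le> s"
      using le_less_trans[OF SUP_le_dim_H[OF N \<phi>] s] by simp
    have "\<not> 1 \<le> hausdorff_content X (dN N) \<phi> \<delta> s"
    proof
      assume "1 \<le> hausdorff_content X (dN N) \<phi> \<delta> s"
      then have "ereal s \<le> dim_H X (dN N) \<phi> \<delta>"
        unfolding dim_H_def using s_ge by (intro Sup_upper) blast
      then show False using s by simp
    qed
    then obtain E :: "nat \<Rightarrow> 'a set" where E: "(\<Union>i. E i) = topspace X" "\<And>i. diam (dN N) (E i) < \<delta>"
      "(\<Sum>i. ennreal (hausdorff_term (dN N) \<phi> s (E i))) < 1"
      unfolding hausdorff_content_def not_le Inf_less_iff by blast
    have EX: "E k \<subseteq> topspace X" for k using E(1) by blast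
    \<comment> \<open>The image of \<open>E k\<close> lies in the box of half-width \<open>w k\<close> around the image of one point of \<open>E k\<close>.\<close>
    define e where "e k = (SOME x. x \<in> E k)" for k
    have e: "e k \<in> E k" if "x \<in> E k" for x k using that unfolding e_def by (rule someI)
    define w where "w k = 4 / \<eta> * diam (dN N) (E k)" for k
    define \<sigma> where "\<sigma> k = (SUP x\<in>E k. \<phi> x)" for k
    \<comment> \<open>The least number of coincidences with \<open>t\<close> that is to be excluded on \<open>E k\<close>.  For an empty \<open>E k\<close> any
      positive number does, since its box has width 0.\<close>
    define m where "m k = (if E k = {} then 1 else nat \<lceil>s + c - \<sigma> k\<rceil>)" for k
    let ?F = "\<lambda>i x. bump \<eta> (snd i) ((T ^^ fst i) x)"
    have w_nonneg: "0 \<le> w k" for k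
      using diam_dN_nonneg[OF N EX] \<eta> by (simp add: w_def)
    have \<sigma>_le: "\<sigma> k \<le> s" if "E k \<noteq> {}" for k
    proof -
      have "\<sigma> k \<le> (SUP x\<in>topspace X. \<phi> x)"
        unfolding \<sigma>_def using that EX by (intro cSUP_subset_mono cont_bdd_above \<phi>) auto
      then show ?thesis using s_ge by linarith
    qed
    have m_ge: "s + c - \<sigma> k \<le> real (m k)" if "E k \<noteq> {}" for k
      using that by (simp add: m_def) linarith
    have m_pos: "1 \<le> m k" for k
    proof (cases "E k = {}")
      case False
      then have "0 < real (m k)" using m_ge[OF False] \<sigma>_le[OF False] c by linarith
      then show ?thesis by simp
    qed (simp add: m_def)
    have "\<exists>t. (\<forall>i\<in>?I. 0 < t i \<and> t i < 1) \<and>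
      (\<forall>k. card {i \<in> ?I. ?F i (e k) - w k \<le> t i \<and> t i \<le> ?F i (e k) + w k} < m k)"
    proof (rule point_avoiding_boxes[OF I(1), where l = "\<lambda>k. 2 * w k"
          and b = "\<lambda>k. ennreal (hausdorff_term (dN N) \<phi> s (E k))"])
      fix k assume mk: "m k \<le> card ?I"
      let ?r = "diam (dN N) (E k)"
      show "ennreal (2 ^ card ?I * (2 * w k) ^ m k) \<le> ennreal (hausdorff_term (dN N) \<phi> s (E k))"
      proof (cases "?r = 0")
        case True
        then have "2 ^ card ?I * (2 * w k) ^ m k = 0" using m_pos[of k] by (simp add: w_def)
        then show ?thesis by (simp only: ennreal_0 zero_le)
      next
        case False
        then have ne: "E k \<noteq> {}" by auto
        have r: "0 < ?r" using False diam_dN_nonneg[OF N EX, of k] by simp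
        have "2 * w k = 8 / \<eta> * ?r" by (simp add: w_def)
        also have "\<dots> \<le> \<Lambda> * ?r" using r by (intro mult_right_mono) (auto simp: \<Lambda>_def)
        finally have "(2 * w k) ^ m k \<le> (\<Lambda> * ?r) ^ m k" using w_nonneg by (intro power_mono) auto
        also have "\<dots> = \<Lambda> ^ m k * ?r ^ m k" by (rule power_mult_distrib)
        also have "\<dots> \<le> \<Lambda> ^ card ?I * (?r powr (s - \<sigma> k) * \<delta> powr c)"
        proof (rule mult_mono)
          show "\<Lambda> ^ m k \<le> \<Lambda> ^ card ?I" using mk by (intro power_increasing) (auto simp: \<Lambda>_def)
          have "?r ^ m k = ?r powr (real (m k))" using r by (simp add: powr_realpow)
          also have "\<dots> \<le> ?r powr (s - \<sigma> k + c)"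
            using r E(2)[of k] \<delta> m_ge[OF ne] by (intro powr_mono') auto
          also have "\<dots> = ?r powr (s - \<sigma> k) * ?r powr c" by (rule powr_add)
          also have "\<dots> \<le> ?r powr (s - \<sigma> k) * \<delta> powr c"
            using r E(2)[of k] c by (intro mult_left_mono powr_mono2) auto
          finally show "?r ^ m k \<le> ?r powr (s - \<sigma> k) * \<delta> powr c" .
        qed (use r in \<open>auto simp: \<Lambda>_def\<close>)
        finally have "2 ^ card ?I * (2 * w k) ^ m k
            \<le> 2 ^ card ?I * (\<Lambda> ^ card ?I * (?r powr (s - \<sigma> k) * \<delta> powr c))"
          by (intro mult_left_mono) auto
        also have "\<dots> = ((2 * \<Lambda>) ^ card ?I * \<delta> powr c) * ?r powr (s - \<sigma> k)"
          by (simp add: power_mult_distrib)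
        also have "\<dots> \<le> 1 * ?r powr (s - \<sigma> k)" using small_N by (intro mult_right_mono) auto
        finally show ?thesis
          using False ne by (intro ennreal_leI) (simp add: hausdorff_term_def \<sigma>_def)
      qed
    qed (use w_nonneg E(3) in auto)
    then obtain t where "\<forall>i\<in>?I. 0 < t i \<and> t i < 1"
      "\<forall>k. card {i \<in> ?I. ?F i (e k) - w k \<le> t i \<and> t i \<le> ?F i (e k) + w k} < m k"
      by (elim exE conjE) (rule that)
    note t = this(1)[THEN bspec] this(2)[THEN spec]
    have "Widim X D \<phi> \<epsilon> \<le> ereal ((s + c) + v)"
    proof (rule Widim_le_count[OF N \<eta> eps \<phi> P near t(1)])
      fix x assume x: "x \<in> topspace X"
      then obtain k where k: "x \<in> E k" using E(1) by blast
      have sub: "{i \<in> ?I. ?F i x = t i} \<subseteq> {i \<in> ?I. ?F i (e k) - w k \<le> t i \<and> t i \<le> ?F i (e k) + w k}"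
      proof
        fix i assume "i \<in> {i \<in> ?I. ?F i x = t i}"
        then have i: "i \<in> ?I" "fst i < N" "snd i \<in> P" "?F i x = t i" by auto
        have ek: "e k \<in> topspace X" using e[OF k] EX by blast
        have "\<bar>?F i x - ?F i (e k)\<bar> \<le> 4 / \<eta> * d ((T ^^ fst i) x) ((T ^^ fst i) (e k))"
          by (rule bump_lipschitz[OF \<eta> subsetD[OF P(2) i(3)] iterate_in[OF x] iterate_in[OF ek]])
        also have "\<dots> \<le> w k"
          unfolding w_def using \<eta> dN_ge[OF i(2)] dN_le_diam[OF N EX k e[OF k]]
          by (intro mult_left_mono) (auto intro: order_trans)
        finally have "?F i (e k) - w k \<le> t i \<and> t i \<le> ?F i (e k) + w k"
          using i(4) by linarith
        then show "i \<in> {i \<in> ?I. ?F i (e k) - w k \<le> t i \<and> t i \<le> ?F i (e k) + w k}"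
          using i(1) by simp
      qed
      have "card {i \<in> ?I. ?F i x = t i}
          \<le> card {i \<in> ?I. ?F i (e k) - w k \<le> t i \<and> t i \<le> ?F i (e k) + w k}"
        using I(1) by (intro card_mono sub) simp
      also have "\<dots> < m k" by (rule t(2))
      finally have "card {i \<in> ?I. ?F i x = t i} < m k" .
      then have "int (card {i \<in> ?I. ?F i x = t i}) < \<lceil>s + c - \<sigma> k\<rceil>"
        using k by (auto simp: m_def split: if_splits)
      then have "real (card {i \<in> ?I. ?F i x = t i}) < s + c - \<sigma> k"
        by (simp add: less_ceiling_iff)
      moreover have "\<phi> x \<le> \<sigma> k" unfolding \<sigma>_def by (rule le_SUP[OF \<phi> EX k])
      ultimately show "real (card {i \<in> ?I. ?F i x = t i}) + \<phi> x < s + c" by linarith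
    qed
    then show ?thesis by (simp add: add.assoc)
  qed
  have "ereal (SUP x\<in>topspace X. \<phi> x) \<le> dim_H X (dN N) \<phi> \<delta>" by (rule SUP_le_dim_H[OF N \<phi>])
  then show ?thesis
  proof (cases "dim_H X (dN N) \<phi> \<delta>")
    case (real h)
    show ?thesis
    proof (rule ereal_le_epsilon2)
      fix r :: real assume "0 < r"
      then have "Widim X D \<phi> \<epsilon> \<le> ereal ((h + r) + (c + v))" using real by (intro main) simp
      then show "Widim X D \<phi> \<epsilon> \<le> dim_H X (dN N) \<phi> \<delta> + ereal (\<tau> * real N + v) + ereal r"
        using real by (simp add: c_def algebra_simps)
    qed
  qed auto
qed

lemma variation_upper:
  assumes \<phi>: "continuous_map X euclideanreal \<phi>"
    and "x \<in> topspace X" "y \<in> topspace X" "\<delta> x y < \<eta>"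
  shows "\<phi> x \<le> \<phi> y + variation X \<eta> \<phi> \<delta>"
proof -
  obtain B where B: "\<And>x. x \<in> topspace X \<Longrightarrow> \<bar>\<phi> x\<bar> \<le> B" using cont_bounded[OF \<phi>] by blast
  have "\<bar>\<phi> x - \<phi> y\<bar> \<le> variation X \<eta> \<phi> \<delta>"
    unfolding variation_def
  proof (rule cSup_upper)
    show "bdd_above {\<bar>\<phi> x - \<phi> y\<bar> |x y. x \<in> topspace X \<and> y \<in> topspace X \<and> \<delta> x y < \<eta>}"
    proof (rule bdd_aboveI[of _ "2 * B"], clarify)
      fix x y assume "x \<in> topspace X" "y \<in> topspace X"
      then show "\<bar>\<phi> x - \<phi> y\<bar> \<le> 2 * B" using B[of x] B[of y] by linarith
    qed
  qed (use assms in blast)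
  then show ?thesis by linarith
qed

text \<open>
  The quantifiers are chosen in the order \<open>\<epsilon>\<close>, \<open>e\<close>, \<open>\<eta>\<close>, \<open>P\<close>, \<open>\<delta>\<close>, and only then \<open>N\<close> tends to infinity: half of
  the error \<open>e\<close> pays for the volume estimate and half for the variation of the potential.
\<close>

lemma mdim_le_mdim_H:
  assumes \<phi>: "subadditive_potential X T \<phi>" and bd: "bounded_distortion X T d \<phi>"
    and d': "compatible_metric X d'"
  shows "mdim X T d' \<phi> \<le> mdim_H X T d \<phi>"
proof -
  interpret D: compact_system X T d'
    using dyn d' nonempty by unfold_locales
  have cont: "continuous_map X euclideanreal (\<phi> n)" if "1 \<le> n" for n
    using \<phi> that by (simp add: subadditive_potential_def)
  have main: "lim (\<lambda>N. Widim X (D.dN N) (\<phi> N) \<epsilon> / ereal (real N)) \<le> mdim_H X T d \<phi> + ereal e"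
    if eps: "0 < \<epsilon>" and e: "0 < e" for \<epsilon> e
  proof -
    define \<tau> where "\<tau> = e / 2"
    have \<tau>: "0 < \<tau>" using e by (simp add: \<tau>_def)
    obtain \<eta>0 where \<eta>0: "0 < \<eta>0"
      "\<And>x y. x \<in> topspace X \<Longrightarrow> y \<in> topspace X \<Longrightarrow> d x y < \<eta>0 \<Longrightarrow> d' x y \<le> \<epsilon> / 2"
      using compatible_metric_uniformly_small[OF d', of "\<epsilon> / 2"] eps by auto
    have "\<forall>\<^sub>F \<eta> in at_right 0. limsup (\<lambda>n. ereal (variation X \<eta> (\<phi> n) (dN n) / real n)) < ereal \<tau>"
      using bd \<tau> unfolding bounded_distortion_def by (intro order_tendstoD(2)) auto
    moreover have "\<forall>\<^sub>F \<eta> in at_right 0. \<eta> \<in> {0<..<\<eta>0}"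
      using \<eta>0(1) by (rule eventually_at_right_real)
    ultimately have "\<forall>\<^sub>F \<eta> in at_right (0::real). 0 < \<eta> \<and> \<eta> < \<eta>0 \<and>
        limsup (\<lambda>n. ereal (variation X \<eta> (\<phi> n) (dN n) / real n)) < ereal \<tau>"
      by eventually_elim auto
    then obtain \<eta> where \<eta>: "0 < \<eta>" "\<eta> < \<eta>0"
      "limsup (\<lambda>n. ereal (variation X \<eta> (\<phi> n) (dN n) / real n)) < ereal \<tau>"
      by (auto dest!: eventually_happens simp: trivial_limit_at_right_real)
    obtain P where P: "finite P" "P \<subseteq> topspace X" "\<And>x. x \<in> topspace X \<Longrightarrow> \<exists>p\<in>P. d p x < \<eta> / 4"
      using finite_net[of 1 "\<eta> / 4"] \<eta>(1) unfolding dyn_metric_1 by auto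
    define A where "A = (2 * max 1 (8 / \<eta>)) ^ card P"
    have A: "0 < A" by (simp add: A_def)
    define \<delta> where "\<delta> = min (1 / 2) (A powr (- 1 / \<tau>))"
    have \<delta>: "0 < \<delta>" "\<delta> < 1" using A by (auto simp: \<delta>_def)
    have small: "A * \<delta> powr \<tau> \<le> 1"
    proof -
      have "\<delta> powr \<tau> \<le> (A powr (- 1 / \<tau>)) powr \<tau>"
        using \<tau> \<delta> by (intro powr_mono2) (auto simp: \<delta>_def)
      also have "\<dots> = A powr (- 1 / \<tau> * \<tau>)" by (rule powr_powr)
      also have "\<dots> = 1 / A" using \<tau> A by (simp add: powr_minus_divide)
      finally show ?thesis using A by (simp add: field_simps)
    qed
    have "\<forall>\<^sub>F n in sequentially. ereal (variation X \<eta> (\<phi> n) (dN n) / real n) < ereal \<tau>"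
      using \<eta>(3) by (rule Limsup_lessD)
    then have ev: "\<forall>\<^sub>F n in sequentially. Widim X (D.dN n) (\<phi> n) \<epsilon> / ereal (real n)
        \<le> dim_H X (dN n) (\<phi> n) \<delta> / ereal (real n) + ereal e"
      using eventually_ge_at_top[of 1]
    proof eventually_elim
      case (elim n)
      then have n: "1 \<le> n" and var: "variation X \<eta> (\<phi> n) (dN n) \<le> \<tau> * real n"
        by (auto simp: field_simps)
      have "Widim X (D.dN n) (\<phi> n) \<epsilon> \<le> dim_H X (dN n) (\<phi> n) \<delta> + ereal (\<tau> * real n + \<tau> * real n)"
      proof (rule Widim_le_dim_H[OF n \<eta>(1) eps cont[OF n] P _ \<tau> \<delta> small[unfolded A_def]])
        fix x y assume xy: "x \<in> topspace X" "y \<in> topspace X" "dN n x y < \<eta>"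
        have "d' ((T ^^ k) x) ((T ^^ k) y) \<le> \<epsilon> / 2" if "k < n" for k
          using \<eta>0(2) iterate_in xy \<eta>(2) dN_ge[OF that, of x y] by force
        then have "\<forall>k<n. d' ((T ^^ k) x) ((T ^^ k) y) \<le> \<epsilon> / 2" by simp
        then have "D.dN n x y \<le> \<epsilon> / 2" by (rule dyn_metric_le_iff[OF n, THEN iffD2])
        moreover have "\<phi> n x \<le> \<phi> n y + \<tau> * real n"
          using variation_upper[OF cont[OF n] xy(1,2), of "dN n" \<eta>] xy(3) var by linarith
        ultimately show "\<phi> n x \<le> \<phi> n y + \<tau> * real n \<and> D.dN n x y \<le> \<epsilon> / 2" by blast
      qed
      also have "\<tau> * real n + \<tau> * real n = e * real n" by (simp add: \<tau>_def field_simps)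
      finally have "Widim X (D.dN n) (\<phi> n) \<epsilon> / ereal (real n)
          \<le> (dim_H X (dN n) (\<phi> n) \<delta> + ereal (e * real n)) / ereal (real n)"
        using n by (intro ereal_divide_right_mono) auto
      also have "\<dots> = dim_H X (dN n) (\<phi> n) \<delta> / ereal (real n) + ereal e"
        using n by (cases "dim_H X (dN n) (\<phi> n) \<delta>") (auto simp: field_simps)
      finally show ?case .
    qed
    have "lim (\<lambda>N. Widim X (D.dN N) (\<phi> N) \<epsilon> / ereal (real N))
        = limsup (\<lambda>N. Widim X (D.dN N) (\<phi> N) \<epsilon> / ereal (real N))"
      using D.Widim_convergent[OF \<phi> eps] by (rule convergent_limsup_cl[symmetric])
    also have "\<dots> \<le> limsup (\<lambda>n. dim_H X (dN n) (\<phi> n) \<delta> / ereal (real n) + ereal e)"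
      using ev by (rule Limsup_mono)
    also have "\<dots> = limsup (\<lambda>n. dim_H X (dN n) (\<phi> n) \<delta> / ereal (real n)) + ereal e"
      by (rule Limsup_add_ereal_right) auto
    also have "\<dots> \<le> mdim_H X T d \<phi> + ereal e"
      unfolding mdim_H_eq using \<delta>(1) by (intro add_right_mono SUP_upper) auto
    finally show ?thesis .
  qed
  have "lim (\<lambda>N. Widim X (D.dN N) (\<phi> N) \<epsilon> / ereal (real N)) \<le> mdim_H X T d \<phi>"
    if "0 < \<epsilon>" for \<epsilon>
    by (rule ereal_le_epsilon2) (rule main[OF that])
  then show ?thesis unfolding D.mdim_eq[OF \<phi>] by (intro SUP_least) simp
qed

end

section \<open>The empty space and the theorem\<close>

text \<open>
  For empty \<open>X\<close>, where the suprema of real-valued functions carry no information, both dimensions are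
  \<open>-\<infinity>\<close>.
\<close>

lemma mdim_H_empty:
  assumes "topspace X = {}"
  shows "mdim_H X T d \<phi> = -\<infinity>"
proof -
  have "dim_H X \<delta> \<psi> \<epsilon> = -\<infinity>" if eps: "0 < \<epsilon>" for \<delta> \<psi> \<epsilon>
  proof -
    have "hausdorff_content X \<delta> \<psi> \<epsilon> s \<le> (\<Sum>i::nat. ennreal (hausdorff_term \<delta> \<psi> s {}))" for s
      unfolding hausdorff_content_def using assms eps
      by (intro Inf_lower CollectI exI[of _ "\<lambda>_. {}"]) auto
    then have "hausdorff_content X \<delta> \<psi> \<epsilon> s = 0" for s by (simp add: hausdorff_term_def)
    then show ?thesis by (simp add: dim_H_def bot_ereal_def)
  qed
  then have "limsup (\<lambda>N. dim_H X (dyn_metric T d N) (\<phi> N) \<epsilon> / ereal (real N)) = -\<infinity>" if "0 < \<epsilon>" for \<epsilon>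
  proof -
    have "limsup (\<lambda>N. dim_H X (dyn_metric T d N) (\<phi> N) \<epsilon> / ereal (real N)) \<le> limsup (\<lambda>N. -\<infinity>)"
      using that \<open>\<And>\<epsilon> \<delta> \<psi>. 0 < \<epsilon> \<Longrightarrow> dim_H X \<delta> \<psi> \<epsilon> = -\<infinity>\<close>
      by (intro Limsup_mono eventually_sequentiallyI[of 1]) auto
    then show ?thesis by (simp add: Limsup_const)
  qed
  then have "mdim_H X T d \<phi> \<le> -\<infinity>" unfolding mdim_H_eq by (intro SUP_least) simp
  then show ?thesis by simp
qed

lemma mdim_empty:
  assumes "topspace X = {}"
  shows "mdim X T d \<phi> = -\<infinity>"
proof -
  have W: "Widim X \<delta> \<psi> \<epsilon> = -\<infinity>" if eps: "0 < \<epsilon>" for \<delta> \<psi> \<epsilon>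
  proof -
    have "eps_embedding X \<delta> \<epsilon> (polyhedron_top {}) f" for f
      using assms eps
      by (auto simp: eps_embedding_def polyhedron_top_def polyhedron_of_def continuous_map_def)
    moreover have "finite_complex {}" by (simp add: finite_complex_def)
    ultimately have "Widim X \<delta> \<psi> \<epsilon> \<le> (SUP x\<in>topspace X. ereal (real (local_dim {} (undefined x)) + \<psi> x))"
      unfolding Widim_def
      by (intro Inf_lower CollectI exI[of _ "{}"] exI[of _ undefined] conjI refl)
    then show ?thesis using assms by (simp add: bot_ereal_def)
  qed
  have "lim (\<lambda>N. Widim X (dyn_metric T d N) (\<phi> N) \<epsilon> / ereal (real N)) = -\<infinity>" if "0 < \<epsilon>" for \<epsilon>
  proof (rule limI, rule tendsto_eventually)
    show "\<forall>\<^sub>F N in sequentially. Widim X (dyn_metric T d N) (\<phi> N) \<epsilon> / ereal (real N) = -\<infinity>"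
      using W[OF that] by (intro eventually_sequentiallyI[of 1]) auto
  qed
  then have "\<forall>\<^sub>F \<epsilon> in at_right 0.
      lim (\<lambda>N. Widim X (dyn_metric T d N) (\<phi> N) \<epsilon> / ereal (real N)) = -\<infinity>"
    by (intro eventually_at_rightI[of 0 1]) simp_all
  then show ?thesis
    unfolding mdim_def by (intro tendsto_Lim[OF _ tendsto_eventually]) simp_all
qed

theorem theorem1p3:
  fixes X :: "'a topology"
    and T :: "'a \<Rightarrow> 'a"
    and d :: "'a \<Rightarrow> 'a \<Rightarrow> real"
    and \<phi> :: "nat \<Rightarrow> 'a \<Rightarrow> real"
  assumes "dynamical_system X T"
    and "compatible_metric X d"
    and "subadditive_potential X T \<phi>"
  shows "mdim_H X T d \<phi> \<le> lower_mdim_M X T d \<phi> \<and>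
    (bounded_distortion X T d \<phi> \<and>
     (\<exists>K>0. \<forall>n\<ge>1. \<forall>x\<in>topspace X. \<bar>\<phi> (n + 1) x - \<phi> n x\<bar> < K) \<longrightarrow>
     (\<forall>d'. compatible_metric X d' \<longrightarrow> mdim X T d' \<phi> \<le> mdim_H X T d \<phi>))"
proof (cases "topspace X = {}")
  case True
  then show ?thesis by (simp add: mdim_H_empty mdim_empty)
next
  case False
  then interpret compact_system X T d
    using assms by unfold_locales
  show ?thesis using mdim_H_le_lower_mdim_M mdim_le_mdim_H assms(3) by blast
qed

end
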